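(* Let $2\le n<\infty$, $p\ge 2$, $m'\ge 1$, and let $z:=x^{\otimes p}$ for a nonperiodic element $x\in(\mathcal{V}_{n,m'})_1$. If $\omega$ is a sub-Cuntz state on $\mathcal{O}_n$ by $z$, then there exists $a=(a_1,\ldots,a_p)$ in $\Delta_{p-1}:=\{(b_1,\ldots,b_p)\in\mathbb{R}^p:\sum_j b_j=1,\ b_i\ge 0\text{ for all }i\}$ such that $$\omega=\sum_{j=1}^{p}a_j\,\omega_j,$$ where $\omega_j$ denotes the pure sub-Cuntz state on $\mathcal{O}_n$ by $e^{2\pi j\sqrt{-1}/p}x$. Moreover, $(a_1,\ldots,a_p)$ is unique.
   Context: $\mathcal{O}_n$ ($2\le n<\infty$) is the Cuntz algebra, the universal C$^*$-algebra generated by $s_1,\ldots,s_n$ with $s_i^*s_j=\delta_{ij}I$ and $\sum_{i=1}^n s_is_i^*=I$. For $J=(j_1,\ldots,j_k)\in\{1,\ldots,n\}^k$, $s_J:=s_{j_1}\cdots s_{j_k}$. $\mathcal{V}_{n,m}:=\ell^2(\{1,\ldots,n\}^m)$ is the Hilbert space with orthonormal basis $\{e_J: J\in\{1,\ldots,n\}^m\}$, identified with $(\mathbb{C}^n)^{\otimes m}$ via $e_J\leftrightarrow e_{j_1}\otimes\cdots\otimes e_{j_m}$, so that $\mathcal{V}_{n,m}\otimes\mathcal{V}_{n,l}=\mathcal{V}_{n,m+l}$. $(\mathcal{V}_{n,m})_1$ is the set of unit vectors. For $z=\sum z_Je_J\in(\mathcal{V}_{n,m})_1$, a sub-Cuntz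 state on $\mathcal{O}_n$ by $z$ is a state $\omega$ on $\mathcal{O}_n$ with $\omega(s_J)=\overline{z_J}$ for all $J\in\{1,\ldots,n\}^m$. $z$ is nonperiodic if $z=x^{\otimes p}$ for some $p\ge 1$ and some $x\in\bigcup_{k\ge1}\mathcal{V}_{n,k}$ implies $p=1$. For a nonperiodic unit vector there is exactly one sub-Cuntz state, and it is pure; since $e^{2\pi j\sqrt{-1}/p}x$ is nonperiodic, each $\omega_j$ is well defined. *)

theory Defs
  imports "HOL-Analysis.Analysis"
begin

section \<open>Unital C*-algebras\<close>

text \<open>Nonzero unital complex C*-algebras.  The real Banach algebra structure is taken from the
  library; the complex scalar multiplication extends the real one.\<close>

class cstar_algebra = real_normed_algebra_1 + banach +
  fixes scaleC :: "complex \<Rightarrow> 'a \<Rightarrow> 'a"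
    and star :: "'a \<Rightarrow> 'a"
  assumes scaleC_add_right: "scaleC c (a + b) = scaleC c a + scaleC c b"
    and scaleC_add_left: "scaleC (c + d) a = scaleC c a + scaleC d a"
    and scaleC_scaleC: "scaleC c (scaleC d a) = scaleC (c * d) a"
    and scaleC_of_real: "scaleC (complex_of_real r) a = r *\<^sub>R a"
    and mult_scaleC_left: "scaleC c a * b = scaleC c (a * b)"
    and mult_scaleC_right: "a * scaleC c b = scaleC c (a * b)"
    and norm_scaleC: "norm (scaleC c a) = cmod c * norm a"
    and star_add: "star (a + b) = star a + star b"
    and star_scaleC: "star (scaleC c a) = scaleC (cnj c) (star a)"
    and star_mult: "star (a * b) = star b * star a"
    and star_star: "star (star a) = a"
    and norm_star_mult: "norm (star a * a) = (norm a)\<^sup>2"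

instantiation complex :: cstar_algebra
begin

definition scaleC_complex :: "complex \<Rightarrow> complex \<Rightarrow> complex"
  where "scaleC_complex c a = c * a"

definition star_complex :: "complex \<Rightarrow> complex"
  where "star_complex a = cnj a"

instance
  by standard
    (auto simp: scaleC_complex_def star_complex_def algebra_simps norm_mult power2_eq_square
      scaleR_conv_of_real)

end

definition clinear_map :: "('a::cstar_algebra \<Rightarrow> 'b::cstar_algebra) \<Rightarrow> bool"
  where "clinear_map f \<longleftrightarrow>
    (\<forall>a b. f (a + b) = f a + f b) \<and> (\<forall>c a. f (scaleC c a) = scaleC c (f a))"

definition star_hom :: "('a::cstar_algebra \<Rightarrow> 'b::cstar_algebra) \<Rightarrow> bool"
  where "star_hom f \<longleftrightarrow> clinear_map f \<and> f 1 = 1 \<and>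
    (\<forall>a b. f (a * b) = f a * f b) \<and> (\<forall>a. f (star a) = star (f a))"

definition cstar_subalgebra :: "'a::cstar_algebra set \<Rightarrow> bool"
  where "cstar_subalgebra B \<longleftrightarrow> closed B \<and> 1 \<in> B \<and>
    (\<forall>a\<in>B. \<forall>b\<in>B. a + b \<in> B \<and> a * b \<in> B) \<and>
    (\<forall>c. \<forall>a\<in>B. scaleC c a \<in> B) \<and> (\<forall>a\<in>B. star a \<in> B)"

definition state :: "('a::cstar_algebra \<Rightarrow> complex) \<Rightarrow> bool"
  where "state \<omega> \<longleftrightarrow> clinear_map \<omega> \<and> (\<forall>a. \<omega> (star a * a) \<in> \<real>\<^sub>\<ge>\<^sub>0) \<and> \<omega> 1 = 1"

definition pure_state :: "('a::cstar_algebra \<Rightarrow> complex) \<Rightarrow> bool"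
  where "pure_state \<omega> \<longleftrightarrow> state \<omega> \<and>
    (\<forall>\<phi> \<psi> t. state \<phi> \<and> state \<psi> \<and> 0 < t \<and> t < 1 \<and>
      \<omega> = (\<lambda>a. complex_of_real t * \<phi> a + complex_of_real (1 - t) * \<psi> a)
      \<longrightarrow> \<phi> = \<omega> \<and> \<psi> = \<omega>)"


section \<open>The Cuntz algebra\<close>

definition cuntz_relations :: "nat \<Rightarrow> (nat \<Rightarrow> 'a::cstar_algebra) \<Rightarrow> bool"
  where "cuntz_relations n s \<longleftrightarrow>
    (\<forall>i\<in>{1..n}. \<forall>j\<in>{1..n}. star (s i) * s j = (if i = j then 1 else 0)) \<and>
    (\<Sum>i=1..n. s i * star (s i)) = 1"

text \<open>The type \<open>'a\<close> with \<open>s 1, \<dots>, s n\<close> is the universal C*-algebra generated by elements subject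
  to the Cuntz relations.  HOL cannot quantify over types inside a formula, so the type \<open>'b\<close> of
  the algebras against which universality is tested is a parameter; a theorem assuming
  \<open>cuntz_algebra TYPE('b) n s\<close> is asserted for every \<open>'b\<close>.\<close>

definition cuntz_algebra :: "'b::cstar_algebra itself \<Rightarrow> nat \<Rightarrow> (nat \<Rightarrow> 'a::cstar_algebra) \<Rightarrow> bool"
  where "cuntz_algebra _ n s \<longleftrightarrow>
    cuntz_relations n s \<and>
    cstar_subalgebra hull (s ` {1..n}) = UNIV \<and>
    (\<forall>t :: nat \<Rightarrow> 'b. cuntz_relations n t \<longrightarrow>
      (\<exists>!f :: 'a \<Rightarrow> 'b. star_hom f \<and> (\<forall>i\<in>{1..n}. f (s i) = t i)))"

section \<open>The spaces $\mathcal{V}_{n,m}$\<close>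

definition words :: "nat \<Rightarrow> nat \<Rightarrow> nat list set"
  where "words n m = {J. length J = m \<and> set J \<subseteq> {1..n}}"

text \<open>A vector is represented by its family of coordinates, extended by zero to all lists.\<close>

definition word_space :: "nat \<Rightarrow> nat \<Rightarrow> (nat list \<Rightarrow> complex) set"
  where "word_space n m = {z. \<forall>J. J \<notin> words n m \<longrightarrow> z J = 0}"

definition unit_vectors :: "nat \<Rightarrow> nat \<Rightarrow> (nat list \<Rightarrow> complex) set"
  where "unit_vectors n m = {z \<in> word_space n m. sqrt (\<Sum>J\<in>words n m. (cmod (z J))\<^sup>2) = 1}"

text \<open>Coordinates of \<open>x \<otimes> y\<close> for \<open>x\<close> in \<open>word_space n m\<close> and \<open>y\<close> in \<open>word_space n l\<close>, under the
  identification of the tensor product with \<open>word_space n (m + l)\<close> by concatenation of words.\<close>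

definition tensor :: "nat \<Rightarrow> (nat list \<Rightarrow> complex) \<Rightarrow> (nat list \<Rightarrow> complex) \<Rightarrow> nat list \<Rightarrow> complex"
  where "tensor m x y = (\<lambda>J. x (take m J) * y (drop m J))"

text \<open>The zeroth power is the unit vector of the one-dimensional space \<open>word_space n 0\<close>.\<close>

fun tensor_power :: "nat \<Rightarrow> (nat list \<Rightarrow> complex) \<Rightarrow> nat \<Rightarrow> nat list \<Rightarrow> complex"
  where
    "tensor_power m x 0 = (\<lambda>J. if J = [] then 1 else 0)"
  | "tensor_power m x (Suc p) = tensor m x (tensor_power m x p)"

definition nonperiodic :: "nat \<Rightarrow> (nat list \<Rightarrow> complex) \<Rightarrow> bool"
  where "nonperiodic n z \<longleftrightarrow>
    (\<forall>p\<ge>1. \<forall>k\<ge>1. \<forall>x\<in>word_space n k. z = tensor_power k x p \<longrightarrow> p = 1)"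

section \<open>Sub-Cuntz states\<close>

definition gen_word :: "(nat \<Rightarrow> 'a::cstar_algebra) \<Rightarrow> nat list \<Rightarrow> 'a"
  where "gen_word s J = prod_list (map s J)"

definition sub_cuntz_state ::
    "nat \<Rightarrow> (nat \<Rightarrow> 'a::cstar_algebra) \<Rightarrow> nat \<Rightarrow> (nat list \<Rightarrow> complex) \<Rightarrow> ('a \<Rightarrow> complex) \<Rightarrow> bool"
  where "sub_cuntz_state n s m z \<omega> \<longleftrightarrow>
    z \<in> unit_vectors n m \<and> state \<omega> \<and> (\<forall>J\<in>words n m. \<omega> (gen_word s J) = cnj (z J))"

text \<open>Meaningful for nonperiodic \<open>z\<close>, for which there is exactly one sub-Cuntz state and it is
  pure.\<close>

definition the_pure_sub_cuntz_state ::
    "nat \<Rightarrow> (nat \<Rightarrow> 'a::cstar_algebra) \<Rightarrow> nat \<Rightarrow> (nat list \<Rightarrow> complex) \<Rightarrow> 'a \<Rightarrow> complex"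
  where "the_pure_sub_cuntz_state n s m z = (THE \<omega>. sub_cuntz_state n s m z \<omega> \<and> pure_state \<omega>)"

text \<open>The simplex $\Delta_{p-1}$ in $\mathbb{R}^p$; extensionality makes each tuple
  $(b_1,\dots,b_p)$ a unique function.\<close>

definition prob_simplex :: "nat \<Rightarrow> (nat \<Rightarrow> real) set"
  where "prob_simplex p =
    {b \<in> extensional {1..p}. (\<Sum>j=1..p. b j) = 1 \<and> (\<forall>j\<in>{1..p}. 0 \<le> b j)}"

end

theory Submission
  imports Defs
begin

text \<open>Let \<open>U\<close> be the isometry \<open>\<Sum> x\<^sub>J s\<^sub>J\<close> attached to \<open>x\<close>.  A sub-Cuntz state for a unit vector
  is a state that takes the value 1 at the isometry of that vector
  (\<open>sub_cuntz_state_iff\<close>), and this means that the isometry fixes the GNS vector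
  (\<open>isometry_fixes_state\<close>).  The isometry of \<open>x\<^sup>\<otimes>\<^sup>p\<close> is \<open>U ^ p\<close>.  So the GNS vector of \<open>\<omega>\<close> is fixed by
  \<open>U ^ p\<close> and splits into eigenvectors of \<open>U\<close> for the \<open>p\<close>-th roots of unity; each of them
  gives a multiple of one \<open>\<omega>\<^sub>j\<close>, and its squared length is the coefficient \<open>a\<^sub>j\<close>.  No GNS space is
  needed: the eigenvectors are represented by the elements \<open>spectral_part U j\<close> of the algebra.

  What has to be shown is that the mixed terms between different eigenvectors vanish, and that the
  functional of an eigenvector depends only on its eigenvalue and its length.  Both are cases of \<open>covariant_functional_eq_zero\<close>: a continuous
  functional \<open>f\<close> with \<open>f (U\<^sup>* A) = \<alpha> f A\<close> and \<open>f (A U) = \<beta> f A\<close> for unimodular \<open>\<alpha>\<close> and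
  \<open>\<beta>\<close>, and \<open>f 1 = 0\<close>, is zero.  Here nonperiodicity enters.  The restriction of \<open>f\<close> to words of a
  fixed length is given by a vector \<open>v\<close>, covariance makes \<open>v \<otimes> x\<close> proportional to
  \<open>x \<otimes> v\<close>, and tensors that commute up to a scalar are, like commuting words, multiples of powers
  of a common tensor (\<open>tensor_commute_imp_common_root\<close>).

  For the coefficients to be unique, \<open>\<omega>\<^sub>j\<close> has to exist even if \<open>a\<^sub>j = 0\<close>.  The isometry \<open>U\<close>
  has wandering vectors because \<open>n\<close> is at least 2, hence approximate eigenvectors for every unimodular
  number, and a limit of their vector states is the state sought (\<open>exists_sub_cuntz_state\<close>).  Evaluation at
  \<open>spectral_part U k\<close> then recovers \<open>a\<^sub>k\<close>.\<close>

section \<open>Square roots in C*-algebras\<close>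

lemma scaleC_zero_left [simp]: "scaleC 0 (a::'a::cstar_algebra) = 0"
  using scaleC_of_real[of 0 a] by simp

lemma scaleC_one [simp]: "scaleC 1 (a::'a::cstar_algebra) = a"
  using scaleC_of_real[of 1 a] by simp

lemma scaleC_zero_right [simp]: "scaleC c (0::'a::cstar_algebra) = 0"
  using scaleC_add_right[of c "0::'a" 0] by simp

lemma scaleC_minus_right: "scaleC c (- a) = - scaleC c (a::'a::cstar_algebra)"
  using scaleC_add_right[of c a "- a"] by (simp add: eq_neg_iff_add_eq_0 add.commute)

lemma scaleC_diff_right: "scaleC c (a - b) = scaleC c a - scaleC c (b::'a::cstar_algebra)"
  using scaleC_add_right[of c a "- b"] by (simp add: scaleC_minus_right)

lemma scaleC_sum_right: "scaleC c (sum f A) = (\<Sum>i\<in>A. scaleC c (f i :: 'a::cstar_algebra))"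
  by (induction A rule: infinite_finite_induct) (auto simp: scaleC_add_right)

lemma scaleC_sum_left: "scaleC (sum f A) a = (\<Sum>i\<in>A. scaleC (f i) (a :: 'a::cstar_algebra))"
  by (induction A rule: infinite_finite_induct) (auto simp: scaleC_add_left)

lemma star_zero [simp]: "star (0::'a::cstar_algebra) = 0"
  using star_add[of "0::'a" 0] by simp

lemma star_one [simp]: "star (1::'a::cstar_algebra) = 1"
  using star_mult[of "star (1::'a)" 1] by (simp add: star_star)

lemma star_minus: "star (- a) = - star (a::'a::cstar_algebra)"
  using star_add[of a "- a"] by (simp add: eq_neg_iff_add_eq_0 add.commute)

lemma star_diff: "star (a - b) = star a - star (b::'a::cstar_algebra)"
  using star_add[of a "- b"] by (simp add: star_minus)

lemma star_sum: "star (sum f A) = (\<Sum>i\<in>A. star (f i :: 'a::cstar_algebra))"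
  by (induction A rule: infinite_finite_induct) (auto simp: star_add)

lemma star_power: "star (a ^ k) = star (a::'a::cstar_algebra) ^ k"
  by (induction k) (simp_all add: star_mult power_commutes)

lemma star_scaleR: "star (r *\<^sub>R a) = r *\<^sub>R star (a::'a::cstar_algebra)"
  by (metis star_scaleC scaleC_of_real complex_cnj_complex_of_real)

lemma norm_star [simp]: "norm (star a) = norm (a::'a::cstar_algebra)"
proof -
  have le: "norm b \<le> norm (star b)" for b :: 'a
  proof (cases "b = 0")
    case False
    have "norm b * norm b \<le> norm (star b) * norm b"
      using norm_mult_ineq[of "star b" b] by (simp add: norm_star_mult power2_eq_square)
    with False show ?thesis by simp
  qed simp
  show ?thesis using le[of a] le[of "star a"] by (simp add: star_star)
qed

lemma bounded_linear_star: "bounded_linear (star :: 'a::cstar_algebra \<Rightarrow> 'a)"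
  by (rule bounded_linear_intro[of _ 1]) (simp_all add: star_add star_scaleR)

lemma abs_half_gbinomial_le_one: "\<bar>(1/2::real) gchoose k\<bar> \<le> 1"
proof (induction k)
  case (Suc k)
  have "(1/2::real) gchoose Suc k = (1/2 gchoose k) * ((1/2 - real k) / (1 + real k))"
    using gbinomial_mult_1[of "1/2::real" k] by (simp add: eq_divide_eq algebra_simps)
  moreover have "\<bar>(1/2 - real k) / (1 + real k)\<bar> \<le> 1" by (simp add: abs_le_iff field_simps)
  ultimately show ?case
    using mult_mono[OF Suc.IH, of "\<bar>(1/2 - real k) / (1 + real k)\<bar>" 1] by (simp add: abs_mult)
qed simp

text \<open>The binomial series of \<open>sqrt (1 - h)\<close> converges absolutely, and Vandermonde's identity
  computes its square.  Square roots are what turns the positivity of a state into continuity.\<close>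

lemma sqrt_one_minus:
  fixes h :: "'a::cstar_algebra"
  assumes "norm h < 1" and "star h = h"
  obtains c where "star c = c" and "c * c = 1 - h"
proof -
  define u where "u k = ((1/2::real) gchoose k) *\<^sub>R (- h) ^ k" for k
  have "norm (u k) \<le> norm h ^ k" for k
  proof -
    have "norm (u k) \<le> 1 * norm ((- h) ^ k)"
      unfolding u_def norm_scaleR by (rule mult_right_mono[OF abs_half_gbinomial_le_one]) simp
    also have "\<dots> \<le> norm h ^ k" using norm_power_ineq[of "- h" k] by simp
    finally show ?thesis .
  qed
  then have su: "summable (\<lambda>k. norm (u k))"
    using assms(1) by (intro summable_comparison_test[OF _ summable_geometric[of "norm h"]]) auto
  have conv: "(\<Sum>i\<le>k. u i * u (k - i)) = (1 gchoose k) *\<^sub>R (- h) ^ k" for k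
  proof -
    have "(\<Sum>i\<le>k. u i * u (k - i))
      = (\<Sum>i\<le>k. ((1/2 gchoose i) * (1/2 gchoose (k - i))) *\<^sub>R (- h) ^ k)"
      by (rule sum.cong) (simp_all add: u_def power_add[symmetric])
    also have "\<dots> = (1 gchoose k) *\<^sub>R (- h) ^ k"
      using gbinomial_Vandermonde[of "1/2::real" "1/2" k]
      by (simp add: scaleR_left.sum[symmetric] atMost_atLeast0)
    finally show ?thesis .
  qed
  have "(\<lambda>k. (1 gchoose k) *\<^sub>R (- h) ^ k) sums (suminf u * suminf u)"
    using Cauchy_product_sums[OF su su] by (simp add: conv)
  moreover have "(\<lambda>k. (1 gchoose k) *\<^sub>R (- h) ^ k) sums (\<Sum>k\<in>{0,1}. (1 gchoose k) *\<^sub>R (- h) ^ k)"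
  proof (rule sums_finite)
    fix k :: nat assume "k \<notin> {0, 1}"
    then have "(of_nat 1 :: real) gchoose k = 0"
      by (subst binomial_gbinomial[symmetric]) (simp add: binomial_eq_0)
    then show "((1::real) gchoose k) *\<^sub>R (- h) ^ k = 0" by simp
  qed simp
  ultimately have sq: "suminf u * suminf u = 1 - h"
    by (auto dest: sums_unique2)
  have "star (u k) = u k" for k
    by (simp add: u_def star_scaleR star_power star_minus assms(2))
  then have "star (suminf u) = suminf u"
    using bounded_linear.suminf[OF bounded_linear_star summable_norm_cancel[OF su]] by simp
  with sq show ?thesis using that by blast
qed

section \<open>States\<close>

lemma clinear_map_simps:
  assumes "clinear_map (f :: 'a::cstar_algebra \<Rightarrow> complex)"
  shows "f (a + b) = f a + f b" and "f (scaleC c a) = c * f a" and "f 0 = 0"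
    and "f (- a) = - f a" and "f (a - b) = f a - f b"
    and "f (sum h A) = (\<Sum>i\<in>A. f (h i))"
proof -
  have add: "f (a + b) = f a + f b" for a b using assms by (simp add: clinear_map_def)
  have sc: "f (scaleC c a) = c * f a" for c a
    using assms by (simp add: clinear_map_def scaleC_complex_def)
  have z: "f 0 = 0" using add[of 0 0] by simp
  have m: "f (- a) = - f a" for a
    using add[of a "- a"] by (simp add: z eq_neg_iff_add_eq_0 add.commute)
  show "f (a + b) = f a + f b" "f (scaleC c a) = c * f a" "f 0 = 0" "f (- a) = - f a"
    by (fact add sc z m)+
  show "f (a - b) = f a - f b" using add[of a "- b"] by (simp add: m)
  show "f (sum h A) = (\<Sum>i\<in>A. f (h i))"
    by (induction A rule: infinite_finite_induct) (auto simp: add z)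
qed

lemma stateD:
  assumes "state \<omega>"
  shows "clinear_map \<omega>" and "\<omega> 1 = 1" and "0 \<le> Re (\<omega> (star a * a))" and "Im (\<omega> (star a * a)) = 0"
    and "\<omega> (star a * a) = of_real (Re (\<omega> (star a * a)))"
  using assms by (auto simp: state_def complex_nonneg_Reals_iff complex_eq_iff)

text \<open>Polarization: the values at \<open>a + b\<close> and at \<open>a + \<i> b\<close> are real.\<close>

lemma state_hermitian:
  assumes "state \<omega>"
  shows "\<omega> (star b * a) = cnj (\<omega> (star a * b))"
proof -
  note lin = clinear_map_simps[OF stateD(1)[OF assms]]
  have im: "Im (\<omega> (star a * a)) = 0" for a by (rule stateD(4)[OF assms])
  have expand: "\<omega> (star (a + c) * (a + c))
      = \<omega> (star a * a) + \<omega> (star a * c) + \<omega> (star c * a) + \<omega> (star c * c)" for c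
    by (simp add: star_add algebra_simps lin)
  have "Im (\<omega> (star a * b)) + Im (\<omega> (star b * a)) = 0"
    using arg_cong[OF expand[of b], of Im] by (simp only: im plus_complex.sel)
  moreover have "Re (\<omega> (star a * b)) - Re (\<omega> (star b * a)) = 0"
    using arg_cong[OF expand[of "scaleC \<i> b"], of Im]
    by (simp only: im plus_complex.sel)
       (simp add: star_scaleC mult_scaleC_left mult_scaleC_right lin)
  ultimately show ?thesis by (simp add: complex_eq_iff)
qed

lemma state_star: "state \<omega> \<Longrightarrow> \<omega> (star a) = cnj (\<omega> a)"
  using state_hermitian[of \<omega> a 1] by simp

lemma state_Cauchy_Schwarz:
  assumes "state \<omega>"
  shows "(cmod (\<omega> (star a * b)))\<^sup>2 \<le> Re (\<omega> (star a * a)) * Re (\<omega> (star b * b))"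
proof -
  note lin = clinear_map_simps[OF stateD(1)[OF assms]]
  define \<beta> A C where "\<beta> = \<omega> (star a * b)" and "A = Re (\<omega> (star a * a))"
    and "C = Re (\<omega> (star b * b))"
  have A: "\<omega> (star a * a) = of_real A" and C: "\<omega> (star b * b) = of_real C" and A0: "0 \<le> A"
    and C0: "0 \<le> C"
    unfolding A_def C_def using stateD(3,5)[OF assms] by auto
  have ba: "\<omega> (star b * a) = cnj \<beta>" unfolding \<beta>_def by (rule state_hermitian[OF assms])
  \<comment> \<open>Positivity at the vector \<open>b - r \<beta> a\<close>; for \<open>A > 0\<close> the
    quadratic in \<open>r\<close> is minimal at \<open>r = 1 / A\<close>, and for \<open>A = 0\<close> a large \<open>r\<close> forces \<open>\<beta> = 0\<close>.\<close>
  have quad: "0 \<le> r\<^sup>2 * (cmod \<beta>)\<^sup>2 * A - 2 * r * (cmod \<beta>)\<^sup>2 + C" for r :: real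
  proof -
    have "\<omega> (star (b - scaleC (r * \<beta>) a) * (b - scaleC (r * \<beta>) a))
        = C - r * \<beta> * cnj \<beta> - r * cnj \<beta> * \<beta> + (r * cnj \<beta>) * (r * \<beta>) * A"
      by (simp add: star_diff star_scaleC algebra_simps mult_scaleC_left mult_scaleC_right lin A C
          ba \<beta>_def[symmetric] scaleC_scaleC)
    also have "\<dots> = C - 2 * r * (\<beta> * cnj \<beta>) + r\<^sup>2 * (\<beta> * cnj \<beta>) * A"
      by (simp add: power2_eq_square algebra_simps)
    also have "\<dots> = of_real (r\<^sup>2 * (cmod \<beta>)\<^sup>2 * A - 2 * r * (cmod \<beta>)\<^sup>2 + C)"
      by (simp only: complex_norm_square[symmetric]) simp
    finally show ?thesis using stateD(3)[OF assms] by (metis Re_complex_of_real)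
  qed
  show ?thesis
  proof (cases "A = 0")
    case True
    have "\<beta> = 0"
    proof (rule ccontr)
      assume "\<beta> \<noteq> 0"
      then have "0 \<le> - 2 * (C + 1) + C"
        using quad[of "(C + 1) / (cmod \<beta>)\<^sup>2"] True by simp
      then show False using C0 by simp
    qed
    then show ?thesis using True by (simp add: \<beta>_def A_def)
  next
    case False
    have "0 \<le> C - (cmod \<beta>)\<^sup>2 / A"
      using quad[of "1 / A"] False by (simp add: power2_eq_square)
    then have "(cmod \<beta>)\<^sup>2 \<le> A * C" using False A0 by (simp add: field_simps)
    then show ?thesis by (simp add: A_def C_def \<beta>_def)
  qed
qed

lemma state_null_left:
  assumes "state \<omega>" and "\<omega> (star b * b) = 0"
  shows "\<omega> (a * b) = 0"
  using state_Cauchy_Schwarz[OF assms(1), of "star a" b] assms(2) by (simp add: star_star)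

lemma state_square_le:
  assumes "state \<omega>"
  shows "(cmod (\<omega> a))\<^sup>2 \<le> Re (\<omega> (star a * a))"
  using state_Cauchy_Schwarz[OF assms, of 1 a] stateD(2)[OF assms] by simp

text \<open>A state is only assumed to be positive, and this is where its continuity comes from: for
  \<open>t > (norm a)\<^sup>2\<close> the element \<open>t - a\<^sup>* a\<close> is the square of a selfadjoint one.\<close>

lemma state_norm_le:
  assumes "state \<omega>"
  shows "cmod (\<omega> a) \<le> norm a"
proof -
  note lin = clinear_map_simps[OF stateD(1)[OF assms]]
  have "Re (\<omega> (star a * a)) \<le> t" if t: "t > (norm a)\<^sup>2" for t
  proof -
    have t0: "t > 0" using t by (meson le_less_trans zero_le_power2)
    define h where "h = scaleC (of_real (1 / t)) (star a * a)"
    have "norm h < 1" using t t0 by (simp add: h_def norm_scaleC norm_star_mult norm_divide)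
    moreover have "star h = h" by (simp add: h_def star_scaleC star_mult star_star)
    ultimately obtain c where c: "star c = c" "c * c = 1 - h" by (rule sqrt_one_minus)
    have "\<omega> (star c * c) = 1 - of_real (1 / t) * \<omega> (star a * a)"
      by (simp only: c lin h_def stateD(2)[OF assms])
    then have "0 \<le> Re (1 - of_real (1 / t) * \<omega> (star a * a))"
      using stateD(3)[OF assms, of c] by simp
    then have "0 \<le> 1 - 1 / t * Re (\<omega> (star a * a))" by simp
    then show ?thesis using t0 by (simp add: field_simps)
  qed
  then have "Re (\<omega> (star a * a)) \<le> (norm a)\<^sup>2" by (rule dense_ge)
  with state_square_le[OF assms, of a] have "(cmod (\<omega> a))\<^sup>2 \<le> (norm a)\<^sup>2"
    by (rule order_trans)
  then show ?thesis by (rule power2_le_imp_le) simp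
qed

lemma bounded_clinear_continuous:
  assumes "clinear_map (f :: 'a::cstar_algebra \<Rightarrow> complex)" and "\<And>a. cmod (f a) \<le> C * norm a"
  shows "continuous_on UNIV f"
proof -
  note lin = clinear_map_simps[OF assms(1)]
  have "bounded_linear f"
    by (rule bounded_linear_intro[of _ C])
       (simp_all add: lin assms(2) mult.commute[of _ C] scaleC_of_real[symmetric, where 'a = 'a] scaleR_conv_of_real)
  then show ?thesis by (simp add: linear_continuous_on)
qed

lemma state_vector_continuous:
  assumes "state \<omega>"
  shows "clinear_map (\<lambda>A. \<omega> (b * A * c))" and "continuous_on UNIV (\<lambda>A. \<omega> (b * A * c))"
proof -
  note lin = clinear_map_simps[OF stateD(1)[OF assms]]
  show 1: "clinear_map (\<lambda>A. \<omega> (b * A * c))"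
    by (simp add: clinear_map_def scaleC_complex_def algebra_simps mult_scaleC_left
        mult_scaleC_right lin)
  have "cmod (\<omega> (b * a * c)) \<le> norm b * norm c * norm a" for a
  proof -
    have "cmod (\<omega> (b * a * c)) \<le> norm (b * a * c)" by (rule state_norm_le[OF assms])
    also have "\<dots> \<le> norm (b * a) * norm c" by (rule norm_mult_ineq)
    also have "\<dots> \<le> norm b * norm a * norm c" by (simp add: mult_right_mono norm_mult_ineq)
    finally show ?thesis by (simp add: mult_ac)
  qed
  then show "continuous_on UNIV (\<lambda>A. \<omega> (b * A * c))" by (rule bounded_clinear_continuous[OF 1])
qed

lemma vector_state:
  assumes "state \<omega>" and "\<omega> (star b * b) \<noteq> 0"
  shows "state (\<lambda>A. \<omega> (star b * A * b) / \<omega> (star b * b))"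
proof -
  have pos: "\<omega> (star b * (star a * a) * b) / \<omega> (star b * b) \<in> \<real>\<^sub>\<ge>\<^sub>0" for a
  proof -
    have "\<omega> (star b * (star a * a) * b) = \<omega> (star (a * b) * (a * b))"
      by (simp add: star_mult mult.assoc)
    moreover have "\<dots> \<in> \<real>\<^sub>\<ge>\<^sub>0" and "\<omega> (star b * b) \<in> \<real>\<^sub>\<ge>\<^sub>0"
      using assms(1) unfolding state_def by blast+
    ultimately show ?thesis by (simp only: nonneg_Reals_divide_I)
  qed
  have lin: "clinear_map (\<lambda>A. \<omega> (star b * A * b) / \<omega> (star b * b))"
    using state_vector_continuous(1)[OF assms(1), of "star b" b]
    by (simp add: clinear_map_def scaleC_complex_def add_divide_distrib)
  show ?thesis
    unfolding state_def
  proof (intro conjI allI)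
    show "\<omega> (star b * 1 * b) / \<omega> (star b * b) = 1" using assms(2) by simp
  qed (rule lin, rule pos)
qed

text \<open>Expanding the product gives \<open>\<omega> ((V - 1)\<^sup>* (V - 1)) = 0\<close>, that is, \<open>V\<close> fixes the cyclic
  vector of the GNS representation of \<open>\<omega>\<close>.\<close>

lemma isometry_fixes_state:
  assumes "state \<omega>" and "star V * V = 1" and "\<omega> V = 1"
  shows "\<omega> (A * V) = \<omega> A" and "\<omega> (star V * A) = \<omega> A"
proof -
  note lin = clinear_map_simps[OF stateD(1)[OF assms(1)]]
  have "\<omega> (star (V - 1) * (V - 1)) = 0"
    by (simp add: star_diff left_diff_distrib right_diff_distrib assms(2,3) lin
        stateD(2)[OF assms(1)] state_star[OF assms(1)])
  from state_null_left[OF assms(1) this]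
  have *: "\<omega> (A * V) = \<omega> A" for A by (simp add: algebra_simps lin)
  then show "\<omega> (A * V) = \<omega> A" .
  have "cnj (\<omega> (star V * A)) = \<omega> (star A * V)"
    using state_star[OF assms(1), of "star V * A"] by (simp add: star_mult star_star)
  also have "\<dots> = cnj (\<omega> A)" by (simp add: * state_star[OF assms(1)])
  finally show "\<omega> (star V * A) = \<omega> A" by simp
qed

section \<open>Words and tensors\<close>

lemma finite_words [simp]: "finite (words n m)"
  using finite_lists_length_eq[of "{1..n}" m] by (simp add: words_def conj_commute)

lemma words_zero [simp]: "words n 0 = {[]}"
  by (auto simp: words_def)

lemma append_in_words: "K \<in> words n m \<Longrightarrow> J \<in> words n l \<Longrightarrow> K @ J \<in> words n (m + l)"
  by (auto simp: words_def)

lemma take_in_words: "I \<in> words n (m + l) \<Longrightarrow> take m I \<in> words n m"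
  using set_take_subset[of m I] by (auto simp: words_def)

lemma drop_in_words: "I \<in> words n (m + l) \<Longrightarrow> drop m I \<in> words n l"
  using set_drop_subset[of m I] by (auto simp: words_def)

lemma sum_words_append:
  fixes h :: "nat list \<Rightarrow> 'b::comm_monoid_add"
  shows "(\<Sum>I\<in>words n (m + l). h I) = (\<Sum>K\<in>words n m. \<Sum>J\<in>words n l. h (K @ J))"
proof -
  have "(\<Sum>I\<in>words n (m + l). h I) = (\<Sum>(K, J)\<in>words n m \<times> words n l. h (K @ J))"
    by (rule sum.reindex_bij_witness[of _ "\<lambda>(K, J). K @ J" "\<lambda>I. (take m I, drop m I)"])
       (auto simp: take_in_words drop_in_words append_in_words, auto simp: words_def)
  then show ?thesis by (simp add: sum.cartesian_product)
qed

lemma word_space_zero: "x \<in> word_space n m \<Longrightarrow> J \<notin> words n m \<Longrightarrow> x J = 0"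
  by (simp add: word_space_def)

lemma word_space_ext:
  assumes "x \<in> word_space n m" and "y \<in> word_space n m"
    and "\<And>J. J \<in> words n m \<Longrightarrow> x J = y J"
  shows "x = y"
  using assms by (metis word_space_zero ext)

lemma scale_in_word_space: "x \<in> word_space n m \<Longrightarrow> (\<lambda>J. c * x J) \<in> word_space n m"
  by (simp add: word_space_def)

lemma tensor_append [simp]: "length K = m \<Longrightarrow> tensor m x y (K @ J) = x K * y J"
  by (simp add: tensor_def)

lemma tensor_in_word_space:
  assumes "x \<in> word_space n m" and "y \<in> word_space n l"
  shows "tensor m x y \<in> word_space n (m + l)"
proof -
  have "tensor m x y J = 0" if "J \<notin> words n (m + l)" for J
  proof (rule ccontr)
    assume "tensor m x y J \<noteq> 0"
    then have "take m J \<in> words n m" "drop m J \<in> words n l"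
      using assms word_space_zero by (fastforce simp: tensor_def)+
    then show False using append_in_words[of "take m J" n m "drop m J" l] that by simp
  qed
  then show ?thesis by (simp add: word_space_def)
qed

lemma tensor_assoc: "tensor m x (tensor l y z) = tensor (m + l) (tensor m x y) z"
  by (rule ext) (simp add: tensor_def take_drop add.commute mult.assoc min_def)

lemma tensor_scale_left: "tensor m (\<lambda>J. c * x J) y = (\<lambda>J. c * tensor m x y J)"
  by (simp add: tensor_def mult.assoc)

lemma tensor_scale_right: "tensor m x (\<lambda>J. c * y J) = (\<lambda>J. c * tensor m x y J)"
  by (simp add: tensor_def mult_ac)

lemma tensor_power_add:
  "tensor_power k w (a + b) = tensor (k * a) (tensor_power k w a) (tensor_power k w b)"
proof (induction a)
  case 0
  show ?case by (simp add: tensor_def)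
next
  case (Suc a)
  then show ?case by (simp add: tensor_assoc)
qed

lemma tensor_power_one:
  assumes "w \<in> word_space n k"
  shows "tensor_power k w (Suc 0) = w"
proof (rule ext)
  fix J
  show "tensor_power k w (Suc 0) J = w J"
  proof (cases "length J \<le> k")
    case False
    then show ?thesis using word_space_zero[OF assms, of J] by (simp add: tensor_def words_def)
  qed (simp add: tensor_def)
qed

lemma tensor_power_scale:
  "tensor_power k (\<lambda>J. c * w J) a = (\<lambda>J. c ^ a * tensor_power k w a J)"
  by (induction a) (simp_all add: tensor_scale_left tensor_scale_right mult_ac)

lemma unit_vectors_word_space: "x \<in> unit_vectors n m \<Longrightarrow> x \<in> word_space n m"
  by (simp add: unit_vectors_def)

lemma unit_vectors_sum: "x \<in> unit_vectors n m \<Longrightarrow> (\<Sum>J\<in>words n m. (cmod (x J))\<^sup>2) = 1"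
  by (simp add: unit_vectors_def)

lemma unit_vectors_inner: "x \<in> unit_vectors n m \<Longrightarrow> (\<Sum>J\<in>words n m. cnj (x J) * x J) = 1"
proof -
  assume x: "x \<in> unit_vectors n m"
  have "(\<Sum>J\<in>words n m. cnj (x J) * x J) = of_real (\<Sum>J\<in>words n m. (cmod (x J))\<^sup>2)"
    by (simp only: of_real_sum complex_norm_square mult.commute)
  then show ?thesis by (simp only: unit_vectors_sum[OF x] of_real_1)
qed

lemma inner_tensor:
  "(\<Sum>I\<in>words n (m + l). cnj (tensor m x y I) * tensor m x' y' I) =
    (\<Sum>K\<in>words n m. cnj (x K) * x' K) * (\<Sum>J\<in>words n l. cnj (y J) * y' J)"
  unfolding sum_words_append sum_product
  by (intro sum.cong refl) (simp add: words_def mult_ac)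

section \<open>Commuting tensors\<close>

text \<open>Each tensor keeps its own scalar, since one root cannot absorb both.\<close>

definition common_root ::
    "nat \<Rightarrow> nat \<Rightarrow> (nat list \<Rightarrow> complex) \<Rightarrow> nat \<Rightarrow> (nat list \<Rightarrow> complex) \<Rightarrow> bool"
  where "common_root n m x l v \<longleftrightarrow>
    (\<exists>k w a b c d. k \<ge> 1 \<and> w \<in> word_space n k \<and> m = k * a \<and> l = k * b \<and>
      x = (\<lambda>J. c * tensor_power k w a J) \<and> v = (\<lambda>J. d * tensor_power k w b J))"

lemma common_root_sym: "common_root n m x l v \<Longrightarrow> common_root n l v m x"
  unfolding common_root_def by blast

lemma common_root_zero:
  assumes "x \<in> word_space n m" and "v \<in> word_space n 0" and "m \<ge> 1"
  shows "common_root n m x 0 v"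
proof -
  have "v = (\<lambda>J. v [] * tensor_power m x 0 J)"
    using assms(2) by (auto simp: word_space_def)
  moreover have "x = (\<lambda>J. 1 * tensor_power m x 1 J)"
    using tensor_power_one[OF assms(1)] by simp
  moreover have "m = m * 1" "0 = m * 0" by simp_all
  ultimately show ?thesis
    using assms(1,3) unfolding common_root_def by blast
qed

lemma common_root_tensor:
  assumes "common_root n m x l v"
  shows "common_root n (l + m) (tensor l v x) l v"
proof -
  obtain k w a b c d where *: "k \<ge> 1" "w \<in> word_space n k" "m = k * a" "l = k * b"
      "x = (\<lambda>J. c * tensor_power k w a J)" "v = (\<lambda>J. d * tensor_power k w b J)"
    using assms unfolding common_root_def by blast
  have "tensor l v x = (\<lambda>J. (d * c) * tensor_power k w (b + a) J)"
    by (simp only: *(4-6) tensor_power_add tensor_scale_left tensor_scale_right mult.assoc)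
  moreover have "l + m = k * (b + a)" using *(3,4) by (simp add: distrib_left)
  ultimately show ?thesis using * unfolding common_root_def by blast
qed

text \<open>A coordinate \<open>K\<close> with \<open>v K \<noteq> 0\<close> turns the commutation relation, read at \<open>J @ K\<close>, into a
  formula for \<open>x J\<close> that depends on the first \<open>l\<close> letters of \<open>J\<close> only through \<open>v\<close>.\<close>

lemma tensor_commute_divide:
  assumes "x \<in> word_space n m" and "v \<in> word_space n l" and "v \<noteq> (\<lambda>_. 0)"
    and "l \<le> m" and "\<eta> \<noteq> 0" and "tensor l v x = (\<lambda>J. \<eta> * tensor m x v J)"
  obtains y where "y \<in> word_space n (m - l)" and "x = tensor l v y"
    and "tensor l v y = (\<lambda>J. \<eta> * tensor (m - l) y v J)"
proof -
  obtain K where K: "v K \<noteq> 0" using assms(3) by fastforce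
  then have K_word: "K \<in> words n l" using assms(2) word_space_zero by blast
  define y where "y I = (if I \<in> words n (m - l) then x (I @ K) / (\<eta> * v K) else 0)" for I
  have y_space: "y \<in> word_space n (m - l)" by (simp add: word_space_def y_def)
  have m_eq: "l + (m - l) = m" using assms(4) by simp
  have x_eq: "x = tensor l v y"
  proof (rule word_space_ext[OF assms(1)])
    show "tensor l v y \<in> word_space n m"
      using tensor_in_word_space[OF assms(2) y_space] by (simp add: m_eq)
    fix J assume J: "J \<in> words n m"
    then have len: "length J = m" by (simp add: words_def)
    have "v (take l J) * x (drop l J @ K) = \<eta> * (x J * v K)"
      using fun_cong[OF assms(6), of "J @ K"] len assms(4) by (simp add: tensor_def)
    moreover have "drop l J \<in> words n (m - l)"
      using drop_in_words[of J n l "m - l"] J by (simp add: m_eq)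
    ultimately show "x J = tensor l v y J"
      using K assms(5) by (simp add: tensor_def y_def field_simps)
  qed
  have comm: "tensor l v (tensor l v y) = (\<lambda>J. \<eta> * tensor l v (tensor (m - l) y v) J)"
    using assms(6) by (simp only: tensor_assoc m_eq x_eq[symmetric])
  have "v K * tensor l v y J = v K * (\<eta> * tensor (m - l) y v J)" for J
    using fun_cong[OF comm, of "K @ J"] K_word by (simp add: words_def)
  then have "tensor l v y = (\<lambda>J. \<eta> * tensor (m - l) y v J)" using K by auto
  with y_space x_eq show ?thesis by (rule that)
qed

text \<open>Two tensors that commute up to a scalar are multiples of powers of a common tensor.  As for
  commuting words, the proof is the Euclidean algorithm: the longer of the two has the shorter
  one as a left factor, and the quotient commutes with the shorter one up to the same scalar.\<close>

lemma tensor_commute_imp_common_root: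
  assumes "x \<in> word_space n m" and "v \<in> word_space n l" and "x \<noteq> (\<lambda>_. 0)" and "v \<noteq> (\<lambda>_. 0)"
    and "m + l \<ge> 1" and "\<eta> \<noteq> 0" and "tensor l v x = (\<lambda>J. \<eta> * tensor m x v J)"
  shows "common_root n m x l v"
  using assms
proof (induction "m + l" arbitrary: x v m l \<eta> rule: less_induct)
  case less
  have swap: "tensor m x v = (\<lambda>J. inverse \<eta> * tensor l v x J)"
    using less.prems(6,7) by (simp add: fun_eq_iff)
  consider "l = 0" | "m = 0" | "0 < l" "l \<le> m" | "0 < m" "m \<le> l" by linarith
  then show ?case
  proof cases
    case 1
    then show ?thesis using less.prems by (simp add: common_root_zero)
  next
    case 2
    then show ?thesis using less.prems by (simp add: common_root_sym common_root_zero)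
  next
    case 3
    obtain y where y: "y \<in> word_space n (m - l)" "x = tensor l v y"
      "tensor l v y = (\<lambda>J. \<eta> * tensor (m - l) y v J)"
      using tensor_commute_divide[OF less.prems(1,2,4) 3(2) less.prems(6,7)] .
    have "y \<noteq> (\<lambda>_. 0)" using less.prems(3) y(2) by (auto simp: tensor_def)
    then have "common_root n (m - l) y l v"
      using less.hyps[OF _ y(1) less.prems(2) _ less.prems(4) _ less.prems(6) y(3)] 3 by simp
    from common_root_tensor[OF this] show ?thesis using 3 by (simp add: y(2)[symmetric])
  next
    case 4
    have eta: "inverse \<eta> \<noteq> 0" using less.prems(6) by simp
    obtain y where y: "y \<in> word_space n (l - m)" "v = tensor m x y"
      "tensor m x y = (\<lambda>J. inverse \<eta> * tensor (l - m) y x J)"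
      using tensor_commute_divide[OF less.prems(2,1,3) 4(2) eta swap] .
    have "y \<noteq> (\<lambda>_. 0)" using less.prems(4) y(2) by (auto simp: tensor_def)
    then have "common_root n (l - m) y m x"
      using less.hyps[OF _ y(1) less.prems(1) _ less.prems(3) _ eta y(3)] 4 by simp
    from common_root_tensor[OF this] show ?thesis
      using 4 by (simp add: y(2)[symmetric] common_root_sym)
  qed
qed

text \<open>A common root of \<open>x\<close> and \<open>v\<close> is a multiple of \<open>x\<close> when \<open>x\<close> has no proper root.\<close>

lemma nonperiodic_commute:
  assumes "nonperiodic n x" and "x \<in> word_space n m" and "m \<ge> 1" and "x \<noteq> (\<lambda>_. 0)"
    and "v \<in> word_space n l" and "v \<noteq> (\<lambda>_. 0)"
    and "\<eta> \<noteq> 0" and "tensor l v x = (\<lambda>J. \<eta> * tensor m x v J)"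
  shows "\<exists>b d. l = m * b \<and> v = (\<lambda>J. d * tensor_power m x b J)"
proof -
  obtain k w a b c d where *: "k \<ge> 1" "w \<in> word_space n k" "m = k * a" "l = k * b"
      "x = (\<lambda>J. c * tensor_power k w a J)" "v = (\<lambda>J. d * tensor_power k w b J)"
    using tensor_commute_imp_common_root[OF assms(2,5,4,6) _ assms(7,8)] assms(3)
    unfolding common_root_def by (metis trans_le_add1)
  have a: "a \<ge> 1" using *(3) assms(3) by (cases a) auto
  have c: "c \<noteq> 0" using *(5) assms(4) by auto
  \<comment> \<open>The scalar \<open>c\<close> is absorbed into the root, which needs an \<open>a\<close>-th root of it.\<close>
  define r where "r = exp (Ln c / of_nat a)"
  have r: "r ^ a = c" using a c by (simp add: r_def exp_of_nat_mult[symmetric])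
  have "x = tensor_power k (\<lambda>J. r * w J) a" by (simp add: tensor_power_scale r *(5))
  then have "a = 1"
    using assms(1) a *(1) scale_in_word_space[OF *(2), of r] unfolding nonperiodic_def by blast
  then have m: "m = k" and x: "x = (\<lambda>J. c * w J)"
    using *(3,5) tensor_power_one[OF *(2)] by simp_all
  have "v = (\<lambda>J. (d / c ^ b) * tensor_power m x b J)"
    using c by (simp add: *(6) m x tensor_power_scale)
  then show ?thesis using *(4) m by blast
qed

text \<open>The equality case of the Cauchy-Schwarz inequality: the squared length of \<open>v - \<gamma> u\<close> expands
  to zero.\<close>

lemma inner_eq_imp_scaled:
  fixes u v :: "'i \<Rightarrow> complex"
  assumes "finite S" and "(\<Sum>i\<in>S. cnj (u i) * u i) = N" and "(\<Sum>i\<in>S. cnj (v i) * v i) = N"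
    and "(\<Sum>i\<in>S. cnj (u i) * v i) = \<gamma> * N" and "cmod \<gamma> = 1" and "i \<in> S"
  shows "v i = \<gamma> * u i"
proof -
  have g: "\<gamma> * cnj \<gamma> = 1" using assms(5) by (simp add: complex_norm_square[symmetric])
  have N: "cnj N = N" using arg_cong[OF assms(2), of cnj] assms(2) by (simp add: mult.commute)
  have vu: "(\<Sum>i\<in>S. cnj (v i) * u i) = cnj \<gamma> * N"
    using arg_cong[OF assms(4), of cnj] by (simp add: mult.commute N)
  have "complex_of_real (\<Sum>i\<in>S. (cmod (v i - \<gamma> * u i))\<^sup>2)
      = (\<Sum>i\<in>S. cnj (v i - \<gamma> * u i) * (v i - \<gamma> * u i))"
    by (simp only: of_real_sum complex_norm_square mult.commute)
  also have "\<dots> = (\<Sum>i\<in>S. cnj (v i) * v i - \<gamma> * (cnj (v i) * u i) - cnj \<gamma> * (cnj (u i) * v i)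
      + (\<gamma> * cnj \<gamma>) * (cnj (u i) * u i))"
    by (intro sum.cong refl) (simp add: algebra_simps)
  also have "\<dots> = N - \<gamma> * (cnj \<gamma> * N) - cnj \<gamma> * (\<gamma> * N) + (\<gamma> * cnj \<gamma>) * N"
    by (simp add: sum.distrib sum_subtractf sum_distrib_left[symmetric] assms(2,3,4) vu)
  also have "\<dots> = 0" using g by (simp add: mult.assoc[symmetric] mult.commute[of "cnj \<gamma>"])
  finally have "(\<Sum>i\<in>S. (cmod (v i - \<gamma> * u i))\<^sup>2) = 0" by (simp only: of_real_eq_0_iff)
  then have "(cmod (v i - \<gamma> * u i))\<^sup>2 = 0" using assms(1,6) by (simp add: sum_nonneg_eq_0_iff)
  then show ?thesis by simp
qed

section \<open>Cuntz isometries indexed by words\<close>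

text \<open>For a unit vector this is an isometry, the image of \<open>x\<close> under the isometric embedding of the
  space of words into the algebra; tensor products become products.\<close>

definition word_comb ::
    "nat \<Rightarrow> (nat \<Rightarrow> 'a::cstar_algebra) \<Rightarrow> nat \<Rightarrow> (nat list \<Rightarrow> complex) \<Rightarrow> 'a"
  where "word_comb n s m x = (\<Sum>J\<in>words n m. scaleC (x J) (gen_word s J))"

lemma gen_word_Nil [simp]: "gen_word s [] = 1"
  by (simp add: gen_word_def)

lemma gen_word_Cons [simp]: "gen_word s (i # J) = s i * gen_word s J"
  by (simp add: gen_word_def)

lemma gen_word_append: "gen_word s (K @ J) = gen_word s K * gen_word s J"
  by (simp add: gen_word_def)

lemma star_gen_word_mult:
  assumes "cuntz_relations n s" and "K \<in> words n l" and "L \<in> words n l"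
  shows "star (gen_word s K) * gen_word s L = (if K = L then 1 else 0)"
  using assms(2,3)
proof (induction l arbitrary: K L)
  case 0
  then show ?case by simp
next
  case (Suc l)
  obtain i K' where K: "K = i # K'" "i \<in> {1..n}" "K' \<in> words n l"
    using Suc.prems(1) by (cases K) (auto simp: words_def)
  obtain j L' where L: "L = j # L'" "j \<in> {1..n}" "L' \<in> words n l"
    using Suc.prems(2) by (cases L) (auto simp: words_def)
  have rel: "star (s i) * s j = (if i = j then 1 else 0)"
    using assms(1) K(2) L(2) by (simp add: cuntz_relations_def)
  have "star (gen_word s K) * gen_word s L
      = star (gen_word s K') * ((if i = j then 1 else 0) * gen_word s L')"
    unfolding rel[symmetric] by (simp only: K(1) L(1) gen_word_Cons star_mult mult.assoc)
  also have "\<dots> = (if i = j then star (gen_word s K') * gen_word s L' else 0)" by simp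
  also have "\<dots> = (if K = L then 1 else 0)" by (simp only: Suc.IH[OF K(3) L(3)]) (simp add: K(1) L(1))
  finally show ?case .
qed

lemma word_comb_scale: "word_comb n s m (\<lambda>J. c * x J) = scaleC c (word_comb n s m x)"
  by (simp add: word_comb_def scaleC_sum_right scaleC_scaleC)

lemma word_comb_tensor:
  "word_comb n s (m + l) (tensor m x y) = word_comb n s m x * word_comb n s l y"
  unfolding word_comb_def sum_words_append sum_product
  by (intro sum.cong refl)
     (simp add: words_def gen_word_append mult_scaleC_left mult_scaleC_right scaleC_scaleC
       mult.commute)

lemma word_comb_tensor_power:
  "word_comb n s (m * p) (tensor_power m x p) = word_comb n s m x ^ p"
proof (induction p)
  case 0
  show ?case by (simp add: word_comb_def)
next
  case (Suc p)
  then show ?case by (simp add: word_comb_tensor)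
qed

lemma star_word_comb_gen_word:
  assumes "cuntz_relations n s" and "K \<in> words n m"
  shows "star (word_comb n s m x) * gen_word s K = scaleC (cnj (x K)) 1"
proof -
  have "star (word_comb n s m x) * gen_word s K
      = (\<Sum>J\<in>words n m. if J = K then scaleC (cnj (x J)) 1 else 0)"
    unfolding word_comb_def star_sum sum_distrib_right
    by (intro sum.cong refl)
       (simp add: star_scaleC mult_scaleC_left star_gen_word_mult[OF assms(1) _ assms(2)])
  then show ?thesis using assms(2) by simp
qed

lemma word_comb_isometry:
  assumes "cuntz_relations n s" and "x \<in> unit_vectors n m"
  shows "star (word_comb n s m x) * word_comb n s m x = 1"
proof -
  have "star (word_comb n s m x) * word_comb n s m x
      = (\<Sum>K\<in>words n m. scaleC (x K) (star (word_comb n s m x) * gen_word s K))"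
    by (simp add: word_comb_def[of n s m x] sum_distrib_left mult_scaleC_right)
  also have "\<dots> = (\<Sum>K\<in>words n m. scaleC (cnj (x K) * x K) 1)"
    by (intro sum.cong refl)
       (simp add: star_word_comb_gen_word[OF assms(1)] scaleC_scaleC mult.commute)
  also have "\<dots> = scaleC (\<Sum>K\<in>words n m. cnj (x K) * x K) 1"
    by (simp only: scaleC_sum_left)
  also have "\<dots> = 1" by (simp only: unit_vectors_inner[OF assms(2)] scaleC_one)
  finally show ?thesis .
qed

lemma unit_vectors_scale:
  "x \<in> unit_vectors n m \<Longrightarrow> cmod c = 1 \<Longrightarrow> (\<lambda>J. c * x J) \<in> unit_vectors n m"
  by (simp add: unit_vectors_def word_space_def norm_mult)

text \<open>If \<open>U\<close> denotes the isometry of \<open>x\<close>, then \<open>\<omega> U = 1\<close> implies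
  \<open>\<omega> (s\<^sub>J) = \<omega> (U\<^sup>* s\<^sub>J)\<close>, and \<open>U\<^sup>* s\<^sub>J\<close> is the scalar \<open>cnj (x J)\<close>.\<close>

lemma sub_cuntz_state_iff:
  assumes "cuntz_relations n s" and "x \<in> unit_vectors n m"
  shows "sub_cuntz_state n s m x \<omega> \<longleftrightarrow> state \<omega> \<and> \<omega> (word_comb n s m x) = 1"
proof (intro iffI conjI)
  assume "sub_cuntz_state n s m x \<omega>"
  then have st: "state \<omega>" and val: "\<And>J. J \<in> words n m \<Longrightarrow> \<omega> (gen_word s J) = cnj (x J)"
    by (simp_all add: sub_cuntz_state_def)
  show "state \<omega>" by (fact st)
  have "\<omega> (word_comb n s m x) = (\<Sum>J\<in>words n m. cnj (x J) * x J)"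
    by (simp add: word_comb_def clinear_map_simps[OF stateD(1)[OF st]] val mult.commute)
  then show "\<omega> (word_comb n s m x) = 1" by (simp only: unit_vectors_inner[OF assms(2)])
next
  assume st: "state \<omega> \<and> \<omega> (word_comb n s m x) = 1"
  have "\<omega> (gen_word s J) = cnj (x J)" if "J \<in> words n m" for J
  proof -
    have "\<omega> (gen_word s J) = \<omega> (star (word_comb n s m x) * gen_word s J)"
      using isometry_fixes_state(2)[OF _ word_comb_isometry[OF assms], of \<omega>] st by simp
    then show ?thesis
      using st stateD(1,2)[of \<omega>]
      by (simp add: star_word_comb_gen_word[OF assms(1) that] clinear_map_simps)
  qed
  then show "sub_cuntz_state n s m x \<omega>"
    using st assms(2) by (simp add: sub_cuntz_state_def)
qed

section \<open>Rigidity of functionals covariant for a nonperiodic vector\<close>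

text \<open>This says that the linear span of the elements \<open>s\<^sub>J s\<^sub>K\<^sup>*\<close> is dense, but the proof avoids
  the span, whose closure under multiplication would need a separate argument.  Let \<open>E\<close> be the
  closed subspace of all \<open>B\<close> such that every \<open>f (s\<^sub>J s\<^sub>K\<^sup>* B)\<close> vanishes.  The elements \<open>A\<close> for
  which \<open>A\<close> and \<open>A\<^sup>*\<close> map \<open>E\<close> into itself by left multiplication form a C*-subalgebra that
  contains the generators, so everything maps \<open>1 \<in> E\<close> into \<open>E\<close>.\<close>

lemma functional_eq_zero:
  fixes s :: "nat \<Rightarrow> 'a::cstar_algebra"
  assumes R: "cuntz_relations n s" and gen: "cstar_subalgebra hull (s ` {1..n}) = UNIV"
    and f: "clinear_map f" "continuous_on UNIV f"
    and zero: "\<And>J K. set J \<subseteq> {1..n} \<Longrightarrow> set K \<subseteq> {1..n} \<Longrightarrow> f (gen_word s J * star (gen_word s K)) = 0"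
  shows "f A = (0::complex)"
proof -
  note lin = clinear_map_simps[OF f(1)]
  define E where "E = {B. \<forall>J K. set J \<subseteq> {1..n} \<longrightarrow> set K \<subseteq> {1..n} \<longrightarrow>
    f (gen_word s J * star (gen_word s K) * B) = 0}"
  have E_iff: "B \<in> E \<longleftrightarrow> (\<forall>J K. set J \<subseteq> {1..n} \<longrightarrow> set K \<subseteq> {1..n} \<longrightarrow>
    f (gen_word s J * star (gen_word s K) * B) = 0)" for B by (simp add: E_def)
  have cont: "continuous_on UNIV (\<lambda>B. f (C * B))" for C
    by (rule continuous_on_compose2[OF f(2)]) (auto intro!: continuous_intros)
  have closed_E: "closed E"
    unfolding E_def by (intro closed_Collect_all closed_Collect_imp closed_Collect_eq cont) auto
  have E_add: "B + C \<in> E" if "B \<in> E" "C \<in> E" for B C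
    using that by (simp add: E_iff distrib_left lin)
  have E_scale: "scaleC c B \<in> E" if "B \<in> E" for B c
    using that by (simp add: E_iff mult_scaleC_right lin)
  have E_one: "1 \<in> E" using zero by (simp add: E_iff)
  have E_gen: "s i * B \<in> E" "star (s i) * B \<in> E" if i: "i \<in> {1..n}" and B: "B \<in> E" for i B
  proof -
    have "f (gen_word s J * star (gen_word s K) * (s i * B)) = 0"
      if JK: "set J \<subseteq> {1..n}" "set K \<subseteq> {1..n}" for J K
    proof (cases K)
      case Nil
      have "f (gen_word s (J @ [i]) * star (gen_word s []) * B) = 0"
        using B JK i unfolding E_iff by (metis Un_subset_iff empty_set empty_subsetI insert_subset
          list.set(2) set_append)
      then show ?thesis using Nil by (simp add: gen_word_append mult.assoc)
    next
      case (Cons k K')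
      have rel: "star (s k) * s i = (if k = i then 1 else 0)"
        using R i JK Cons by (auto simp: cuntz_relations_def)
      have "gen_word s J * star (gen_word s K) * (s i * B)
          = gen_word s J * star (gen_word s K') * ((star (s k) * s i) * B)"
        using Cons by (simp add: star_mult mult.assoc)
      moreover have "f (gen_word s J * star (gen_word s K') * B) = 0"
        using B JK Cons by (simp add: E_iff)
      ultimately show ?thesis by (simp add: rel lin)
    qed
    then show "s i * B \<in> E" by (simp add: E_iff)
    have "f (gen_word s J * star (gen_word s K) * (star (s i) * B)) = 0"
      if "set J \<subseteq> {1..n}" "set K \<subseteq> {1..n}" for J K
    proof -
      have "f (gen_word s J * star (gen_word s (i # K)) * B) = 0"
        using B that i unfolding E_iff by (metis insert_subset list.set(2))
      then show ?thesis by (simp add: star_mult mult.assoc)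
    qed
    then show "star (s i) * B \<in> E" by (simp add: E_iff)
  qed
  define M where "M = {A. \<forall>B\<in>E. A * B \<in> E \<and> star A * B \<in> E}"
  have "closed M"
  proof -
    have "continuous_on UNIV (\<lambda>A. A * B)" "continuous_on UNIV (\<lambda>A. star A * B)" for B :: 'a
      by (intro continuous_intros linear_continuous_on[OF bounded_linear_star])+
    then have "closed ((\<lambda>A. A * B) -` E)" "closed ((\<lambda>A. star A * B) -` E)" for B
      using closed_E by (auto intro: closed_vimage)
    moreover have "M = (\<Inter>B\<in>E. ((\<lambda>A. A * B) -` E) \<inter> ((\<lambda>A. star A * B) -` E))"
      by (auto simp: M_def)
    ultimately show ?thesis by (auto intro!: closed_INT closed_Int)
  qed
  then have "cstar_subalgebra M"
    unfolding cstar_subalgebra_def M_def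
    by (auto simp: star_add star_mult star_scaleC star_star distrib_right mult.assoc
        mult_scaleC_left E_add E_scale)
  moreover have "s ` {1..n} \<subseteq> M" using E_gen by (auto simp: M_def)
  ultimately have "M = UNIV" using hull_minimal[of "s ` {1..n}" M cstar_subalgebra] gen by blast
  then have "A * 1 \<in> E" using E_one unfolding M_def by blast
  then have "\<forall>J K. set J \<subseteq> {1..n} \<longrightarrow> set K \<subseteq> {1..n} \<longrightarrow>
      f (gen_word s J * star (gen_word s K) * A) = 0" by (simp add: E_iff)
  from spec[OF spec[OF this, of "[]"], of "[]"] show ?thesis by simp
qed

text \<open>Put \<open>U = word_comb n s m x\<close> and let \<open>v\<close> be the vector that represents the restriction of
  \<open>f\<close> to words of length \<open>l\<close>.  Covariance under left multiplication by \<open>U\<^sup>*\<close> expresses \<open>f\<close> on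
  words of length \<open>m + l\<close> by \<open>x \<otimes> v\<close>, and covariance under right multiplication by \<open>U\<close> then says
  that \<open>x \<otimes> v\<close> and \<open>v \<otimes> x\<close> satisfy the Cauchy-Schwarz inequality with equality.  So they are
  proportional, and by nonperiodicity \<open>v\<close> is a multiple of a power of \<open>x\<close>; but \<open>f\<close> vanishes on
  the powers of \<open>U\<close>.\<close>

lemma covariant_functional_zero_on_words:
  fixes s :: "nat \<Rightarrow> 'a::cstar_algebra"
  assumes R: "cuntz_relations n s" and x: "x \<in> unit_vectors n m" "nonperiodic n x" and m: "m \<ge> 1"
    and f: "clinear_map f"
    and left: "\<And>A. f (star (word_comb n s m x) * A) = \<alpha> * f A"
    and right: "\<And>A. f (A * word_comb n s m x) = \<beta> * f A"
    and units: "cmod \<alpha> = 1" "cmod \<beta> = 1" and one: "f 1 = 0"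
    and J: "J \<in> words n l"
  shows "f (gen_word s J) = (0::complex)"
proof (rule ccontr)
  assume nz: "f (gen_word s J) \<noteq> 0"
  note lin = clinear_map_simps[OF f]
  define U where "U = word_comb n s m x"
  note left = left[folded U_def] and right = right[folded U_def]
  define v where "v J = (if J \<in> words n l then cnj (f (gen_word s J)) else 0)" for J
  have v_space: "v \<in> word_space n l" by (simp add: word_space_def v_def)
  have x_space: "x \<in> word_space n m" by (rule unit_vectors_word_space[OF x(1)])
  have f_comb: "f (word_comb n s k y) = (\<Sum>J\<in>words n k. y J * f (gen_word s J))" for k y
    by (simp add: word_comb_def lin)
  have f_v: "f (gen_word s J) = cnj (v J)" if "J \<in> words n l" for J using that by (simp add: v_def)
  have x_inner: "(\<Sum>J\<in>words n m. cnj (x J) * x J) = 1" by (rule unit_vectors_inner[OF x(1)])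
  define N where "N = (\<Sum>J\<in>words n l. cnj (v J) * v J)"
  have longer: "\<alpha> * f (gen_word s I) = cnj (tensor m x v I)" if "I \<in> words n (m + l)" for I
  proof -
    have I: "take m I \<in> words n m" "drop m I \<in> words n l" "I = take m I @ drop m I"
      using that take_in_words drop_in_words by auto
    have "\<alpha> * f (gen_word s I) = f (star U * gen_word s (take m I) * gen_word s (drop m I))"
      by (subst I(3)) (simp only: gen_word_append left[symmetric] mult.assoc)
    also have "\<dots> = cnj (x (take m I)) * f (gen_word s (drop m I))"
      by (simp add: U_def star_word_comb_gen_word[OF R I(1)] mult_scaleC_left lin)
    finally show ?thesis by (simp add: f_v[OF I(2)] tensor_def)
  qed
  have "(\<Sum>I\<in>words n (m + l). cnj (tensor m x v I) * tensor l v x I)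
      = (\<Sum>I\<in>words n (m + l). \<alpha> * (tensor l v x I * f (gen_word s I)))"
    by (intro sum.cong refl) (simp add: longer[symmetric])
  also have "\<dots> = \<alpha> * f (word_comb n s (l + m) (tensor l v x))"
    by (simp only: sum_distrib_left[symmetric] f_comb add.commute[of l m])
  also have "\<dots> = (\<alpha> * \<beta>) * f (word_comb n s l v)"
    by (simp add: word_comb_tensor U_def[symmetric] right)
  also have "f (word_comb n s l v) = N"
    unfolding f_comb N_def by (intro sum.cong refl) (simp add: f_v mult.commute)
  finally have cross: "(\<Sum>I\<in>words n (m + l). cnj (tensor m x v I) * tensor l v x I) = \<alpha> * \<beta> * N" .
  have xv: "(\<Sum>I\<in>words n (m + l). cnj (tensor m x v I) * tensor m x v I) = N"
    by (simp only: inner_tensor x_inner N_def) simp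
  have vx: "(\<Sum>I\<in>words n (m + l). cnj (tensor l v x I) * tensor l v x I) = N"
    by (simp only: add.commute[of m l] inner_tensor x_inner N_def) simp
  have ab: "cmod (\<alpha> * \<beta>) = 1" using units by (simp add: norm_mult)
  have comm: "tensor l v x = (\<lambda>J. (\<alpha> * \<beta>) * tensor m x v J)"
  proof (rule word_space_ext)
    show "tensor l v x \<in> word_space n (m + l)"
      using tensor_in_word_space[OF v_space x_space] by (simp add: add.commute)
    show "(\<lambda>J. (\<alpha> * \<beta>) * tensor m x v J) \<in> word_space n (m + l)"
      by (intro scale_in_word_space tensor_in_word_space x_space v_space)
    show "tensor l v x I = (\<alpha> * \<beta>) * tensor m x v I" if "I \<in> words n (m + l)" for I
      by (rule inner_eq_imp_scaled[OF finite_words xv vx cross ab that])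
  qed
  have "v J \<noteq> 0" using nz J by (simp add: v_def)
  then have v0: "v \<noteq> (\<lambda>_. 0)" by auto
  have x0: "x \<noteq> (\<lambda>_. 0)" using x_inner by auto
  have "\<alpha> * \<beta> \<noteq> 0" using units by auto
  then obtain b d where b: "l = m * b" and v: "v = (\<lambda>J. d * tensor_power m x b J)"
    using nonperiodic_commute[OF x(2) x_space m x0 v_space v0 _ comm] by blast
  have "f (U ^ b) = \<beta> ^ b * f 1"
  proof (induction b)
    case (Suc b)
    then show ?case using right[of "U ^ b"] by (simp add: power_commutes)
  qed simp
  then have "f (word_comb n s l (tensor_power m x b)) = 0"
    using one by (simp add: b word_comb_tensor_power U_def)
  moreover have "word_comb n s l v = scaleC d (word_comb n s l (tensor_power m x b))"
    by (subst v) (rule word_comb_scale)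
  moreover have "f (word_comb n s l v) = (\<Sum>J\<in>words n l. v J * cnj (v J))"
    unfolding f_comb by (intro sum.cong refl) (simp add: f_v)
  ultimately have "(\<Sum>J\<in>words n l. v J * cnj (v J)) = 0" by (simp add: lin)
  then have "complex_of_real (\<Sum>J\<in>words n l. (cmod (v J))\<^sup>2) = 0"
    by (simp only: of_real_sum complex_norm_square)
  then have "(\<Sum>J\<in>words n l. (cmod (v J))\<^sup>2) = 0" by (simp only: of_real_eq_0_iff)
  then have "(cmod (v J))\<^sup>2 = 0" using J by (simp add: sum_nonneg_eq_0_iff)
  with \<open>v J \<noteq> 0\<close> show False by simp
qed

text \<open>Right multiplication by a power \<open>U ^ r\<close> with \<open>m r\<close> at least the length of \<open>K\<close> absorbs
  \<open>s\<^sub>K\<^sup>*\<close>, which reduces \<open>s\<^sub>J s\<^sub>K\<^sup>*\<close> to a combination of words.\<close>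

lemma covariant_functional_eq_zero:
  fixes s :: "nat \<Rightarrow> 'a::cstar_algebra"
  assumes R: "cuntz_relations n s" and gen: "cstar_subalgebra hull (s ` {1..n}) = UNIV"
    and x: "x \<in> unit_vectors n m" "nonperiodic n x" and m: "m \<ge> 1"
    and f: "clinear_map f" "continuous_on UNIV f"
    and left: "\<And>A. f (star (word_comb n s m x) * A) = \<alpha> * f A"
    and right: "\<And>A. f (A * word_comb n s m x) = \<beta> * f A"
    and units: "cmod \<alpha> = 1" "cmod \<beta> = 1" and one: "f 1 = 0"
  shows "f A = (0::complex)"
proof (rule functional_eq_zero[OF R gen f])
  note lin = clinear_map_simps[OF f(1)]
  fix J K :: "nat list" assume J: "set J \<subseteq> {1..n}" and K: "set K \<subseteq> {1..n}"
  define U where "U = word_comb n s m x"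
  define r where "r = length K"
  have K_word: "K \<in> words n r" using K by (simp add: r_def words_def)
  have "r \<le> m * r" using m by simp
  then have mr: "r + (m * r - r) = m * r" by simp
  have words: "f (gen_word s J) = 0" if "J \<in> words n l" for J l
    using covariant_functional_zero_on_words[OF R x m f(1) left right units one that] .
  have "f (gen_word s J * star (gen_word s K) * gen_word s L) = 0" if L: "L \<in> words n (m * r)" for L
  proof -
    have L': "take r L \<in> words n r" "drop r L \<in> words n (m * r - r)" "L = take r L @ drop r L"
      using L take_in_words[of L n r "m * r - r"] drop_in_words[of L n r "m * r - r"]
      by (simp_all add: mr)
    have "gen_word s J * star (gen_word s K) * gen_word s L
        = gen_word s J * (star (gen_word s K) * gen_word s (take r L)) * gen_word s (drop r L)"
      by (subst L'(3)) (simp only: gen_word_append mult.assoc)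
    also have "\<dots> = (if K = take r L then gen_word s (J @ drop r L) else 0)"
      by (simp add: star_gen_word_mult[OF R K_word L'(1)] gen_word_append)
    moreover have "f (gen_word s (J @ drop r L)) = 0"
    proof (rule words)
      show "J @ drop r L \<in> words n (length J + (m * r - r))"
        using J L'(2) by (intro append_in_words) (simp_all add: words_def)
    qed
    ultimately show ?thesis by (simp add: lin)
  qed
  then have "f (gen_word s J * star (gen_word s K) * U ^ r) = 0"
    by (simp add: U_def word_comb_tensor_power[symmetric] word_comb_def[of n s "m * r"]
        sum_distrib_left mult_scaleC_right lin)
  moreover have "f (B * U ^ k) = \<beta> ^ k * f B" for B k
  proof (induction k)
    case (Suc k)
    have "f (B * U ^ Suc k) = f (B * U ^ k * U)"
      by (simp only: power_Suc2 mult.assoc)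
    then show ?case using right[of "B * U ^ k"] Suc by (simp add: U_def)
  qed simp
  ultimately show "f (gen_word s J * star (gen_word s K)) = 0" using units by auto
qed

section \<open>Existence of sub-Cuntz states\<close>

text \<open>For the topology of pointwise convergence, in which the states form a closed subset of a
  product of discs.\<close>

lemma compact_states: "compact {\<phi> :: 'a::cstar_algebra \<Rightarrow> complex. state \<phi>}"
proof -
  let ?K = "\<Pi>\<^sub>E a\<in>(UNIV :: 'a set). cball (0::complex) (norm a)"
  have "compactin (product_topology (\<lambda>_. euclidean) (UNIV :: 'a set)) ?K"
    by (simp add: compactin_PiE)
  then have K: "compact ?K" by (simp add: euclidean_product_topology)
  have ev: "continuous_on UNIV (\<lambda>\<phi> :: 'a \<Rightarrow> complex. \<phi> a)" for a by simp
  have "closed {\<phi> :: 'a \<Rightarrow> complex. state \<phi>}"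
    unfolding state_def clinear_map_def scaleC_complex_def
    by (intro closed_Collect_conj closed_Collect_all closed_Collect_eq continuous_intros ev
        closed_vimage[OF closed_nonneg_Reals_complex ev, unfolded vimage_def])
  moreover have "{\<phi> :: 'a \<Rightarrow> complex. state \<phi>} = ?K \<inter> {\<phi>. state \<phi>}"
    by (auto simp: state_norm_le)
  ultimately show ?thesis using compact_Int_closed[OF K] by metis
qed

text \<open>The states \<open>\<phi> N\<close> themselves need not converge, but they have a cluster point.\<close>

lemma state_limit_value:
  assumes "\<And>N. state (\<phi> N :: 'a::cstar_algebra \<Rightarrow> complex)" and "(\<lambda>N. \<phi> N V) \<longlonglongrightarrow> c"
  obtains \<psi> where "state \<psi>" and "\<psi> V = c"
proof -
  let ?F = "filtermap \<phi> sequentially"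
  have "eventually (\<lambda>\<psi>. \<psi> \<in> {\<psi>. state \<psi>}) ?F"
    using assms(1) by (simp add: eventually_filtermap)
  moreover have "?F \<noteq> bot" by (simp add: filtermap_bot_iff)
  ultimately obtain \<psi> where \<psi>: "state \<psi>" "inf (nhds \<psi>) ?F \<noteq> bot"
    using compact_states[where 'a = 'a] unfolding compact_filter by blast
  have "((\<lambda>\<theta>. \<theta> V) \<longlongrightarrow> \<psi> V) (nhds \<psi>)"
  proof (rule topological_tendstoI)
    fix S :: "complex set" assume S: "open S" "\<psi> V \<in> S"
    have "open ((\<lambda>\<theta>. \<theta> V) -` S)"
      by (rule open_vimage[OF S(1) continuous_on_product_coordinates])
    then show "eventually (\<lambda>\<theta>. \<theta> V \<in> S) (nhds \<psi>)"
      unfolding eventually_nhds using S(2) by (intro exI[of _ "(\<lambda>\<theta>. \<theta> V) -` S"]) simp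
  qed
  then have "((\<lambda>\<theta>. \<theta> V) \<longlongrightarrow> \<psi> V) (inf (nhds \<psi>) ?F)" by (rule tendsto_mono[OF inf_le1])
  moreover have "((\<lambda>\<theta>. \<theta> V) \<longlongrightarrow> c) ?F" using assms(2) by (simp add: filterlim_filtermap)
  then have "((\<lambda>\<theta>. \<theta> V) \<longlongrightarrow> c) (inf (nhds \<psi>) ?F)" by (rule tendsto_mono[OF inf_le2])
  ultimately have "\<psi> V = c" using tendsto_unique[OF \<psi>(2)] by blast
  with \<psi>(1) show ?thesis by (rule that)
qed

text \<open>An isometry \<open>V\<close> with a wandering vector \<open>w\<close> acts as a unilateral shift on the orthogonal
  vectors \<open>w, V w, V\<^sup>2 w, \<dots>\<close>, so the partial sums \<open>b N = w + V w + \<dots> + V\<^sup>N\<^sup>-\<^sup>1 w\<close> are approximate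
  eigenvectors for the eigenvalue 1: the vector state of \<open>b (N + 1)\<close> takes the value
  \<open>N / (N + 1)\<close> at \<open>V\<close>.\<close>

lemma exists_state_fixing_isometry:
  fixes V :: "'a::cstar_algebra"
  assumes st: "state \<omega>" and V: "star V * V = 1" and w: "star V * w = 0"
    and nz: "\<omega> (star w * w) \<noteq> 0"
  obtains \<phi> where "state \<phi>" and "\<phi> V = 1"
proof -
  note lin = clinear_map_simps[OF stateD(1)[OF st]]
  define b where "b N = ((\<lambda>y. w + V * y) ^^ N) 0" for N
  have b: "b 0 = 0" "\<And>N. b (Suc N) = w + V * b N" by (simp_all add: b_def)
  have wV: "star w * V = 0" using arg_cong[OF w, of star] by (simp add: star_mult star_star)
  have step: "star (w + V * y) * (w + V * z) = star w * w + star y * z" for y z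
  proof -
    have "star (w + V * y) * (w + V * z)
      = star w * w + (star w * V) * z + star y * (star V * w) + star y * (star V * V) * z"
      by (simp add: star_add star_mult distrib_left distrib_right mult.assoc)
    then show ?thesis by (simp add: wV w V)
  qed
  have bb: "star (b N) * b N = of_nat N * (star w * w)" for N
    by (induction N) (simp_all add: b step distrib_right)
  have bbS: "star (b N) * b (Suc N) = of_nat N * (star w * w)" for N
    by (induction N) (simp_all add: b step distrib_right)
  have bV: "star (b (Suc N)) * (V * b (Suc N)) = star (b N) * b (Suc N)" for N
  proof -
    have "star (b (Suc N)) * (V * b (Suc N))
      = (star w * V) * b (Suc N) + star (b N) * (star V * V) * b (Suc N)"
      by (simp add: b(2)[of N] star_add star_mult distrib_right mult.assoc)
    then show ?thesis by (simp add: wV V)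
  qed
  have om: "\<omega> (of_nat k * B) = of_nat k * \<omega> B" for k B
    by (induction k) (simp_all add: distrib_right lin)
  define \<phi> where "\<phi> N A = \<omega> (star (b (Suc N)) * A * b (Suc N)) / \<omega> (star (b (Suc N)) * b (Suc N))"
    for N A
  have "\<omega> (star (b (Suc N)) * b (Suc N)) \<noteq> 0" for N
    using nz by (simp only: bb om) (simp del: of_nat_Suc)
  then have "state (\<phi> N)" for N unfolding \<phi>_def by (rule vector_state[OF st])
  moreover have "(\<lambda>N. \<phi> N V) \<longlonglongrightarrow> 1"
  proof -
    have "\<phi> N V = of_nat N / of_nat (Suc N)" for N
      using nz by (simp only: \<phi>_def mult.assoc bV bbS bb om) (simp del: of_nat_Suc)
    then show ?thesis using LIMSEQ_n_over_Suc_n[where 'a = complex] by simp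
  qed
  ultimately show ?thesis using state_limit_value that by blast
qed

text \<open>For every word \<open>J\<close> of length \<open>m\<close> the vector \<open>s\<^sub>J - \<langle>x, e\<^sub>J\<rangle> U\<close> is wandering for the isometry \<open>U\<close> given by
  \<open>x\<close>.  It has the squared length \<open>1 - \<bar>x\<^sub>J\<bar>\<^sup>2\<close>, which is nonzero for at least one of any
  two distinct words because \<open>x\<close> is a unit vector.\<close>

lemma exists_sub_cuntz_state:
  fixes s :: "nat \<Rightarrow> 'a::cstar_algebra" and \<omega> :: "'a \<Rightarrow> complex"
  assumes R: "cuntz_relations n s" and n: "n \<ge> 2" and m: "m \<ge> 1" and x: "x \<in> unit_vectors n m"
    and st: "state \<omega>"
  shows "\<exists>\<phi>. sub_cuntz_state n s m x \<phi>"
proof -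
  note lin = clinear_map_simps[OF stateD(1)[OF st]]
  define U where "U = word_comb n s m x"
  have U: "star U * U = 1" unfolding U_def by (rule word_comb_isometry[OF R x])
  have rep: "replicate m i \<in> words n m" if "i \<in> {1..n}" for i
    using that by (auto simp: words_def)
  have two: "replicate m 1 \<in> words n m" "replicate m 2 \<in> words n m"
    using rep[of 1] rep[of 2] n by auto
  obtain J where J: "J \<in> words n m" "(cmod (x J))\<^sup>2 \<noteq> 1"
  proof (rule ccontr)
    assume "\<not> thesis"
    then have "(cmod (x (replicate m 1)))\<^sup>2 = 1" "(cmod (x (replicate m 2)))\<^sup>2 = 1"
      using that two by blast+
    moreover have "replicate m (1::nat) \<noteq> replicate m 2" using m by (simp add: replicate_eq_replicate)
    moreover have "(\<Sum>J\<in>{replicate m 1, replicate m 2}. (cmod (x J))\<^sup>2)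
        \<le> (\<Sum>J\<in>words n m. (cmod (x J))\<^sup>2)"
      using two by (intro sum_mono2) auto
    ultimately show False by (simp add: unit_vectors_sum[OF x])
  qed
  define w where "w = gen_word s J - scaleC (cnj (x J)) U"
  have UJ: "star U * gen_word s J = scaleC (cnj (x J)) 1"
    unfolding U_def by (rule star_word_comb_gen_word[OF R J(1)])
  have JU: "star (gen_word s J) * U = scaleC (x J) 1"
    using arg_cong[OF UJ, of star] by (simp add: star_mult star_star star_scaleC)
  have JJ: "star (gen_word s J) * gen_word s J = 1"
    using star_gen_word_mult[OF R J(1) J(1)] by simp
  have Uw: "star U * w = 0" by (simp add: w_def right_diff_distrib UJ mult_scaleC_right U)
  have "star w * w = star (gen_word s J) * w - scaleC (x J) (star U * w)"
    by (simp add: w_def star_diff star_scaleC left_diff_distrib mult_scaleC_left)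
  then have ww: "star w * w = 1 - scaleC (cnj (x J) * x J) 1"
    by (simp add: Uw) (simp add: w_def right_diff_distrib JJ JU mult_scaleC_right scaleC_scaleC)
  have "\<omega> (star w * w) = 1 - of_real ((cmod (x J))\<^sup>2)"
    by (simp only: ww lin stateD(2)[OF st] complex_norm_square mult_1_left mult_1_right mult.commute)
  also have "\<dots> = of_real (1 - (cmod (x J))\<^sup>2)" by simp
  finally have "\<omega> (star w * w) \<noteq> 0" using J(2) by (simp only: of_real_eq_0_iff)
  then obtain \<phi> where "state \<phi>" "\<phi> U = 1"
    using exists_state_fixing_isometry[OF st U Uw] by blast
  then show ?thesis using sub_cuntz_state_iff[OF R x] unfolding U_def by blast
qed

text \<open>Two sub-Cuntz states for the vector \<open>c x\<close> are equal because their difference is covariant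
  and vanishes at the identity.  Such a state is pure because its value 1 at the isometry \<open>c U\<close> is
  extreme: a convex combination of two states attains it only if both of them do, and then both are
  sub-Cuntz states for \<open>c x\<close>.\<close>

lemma the_pure_sub_cuntz_state_rotated:
  fixes s :: "nat \<Rightarrow> 'a::cstar_algebra" and \<omega> :: "'a \<Rightarrow> complex"
  assumes R: "cuntz_relations n s" and gen: "cstar_subalgebra hull (s ` {1..n}) = UNIV"
    and n: "n \<ge> 2" and m: "m \<ge> 1" and x: "x \<in> unit_vectors n m" "nonperiodic n x"
    and st: "state \<omega>" and c: "cmod c = 1"
  defines "\<phi> \<equiv> the_pure_sub_cuntz_state n s m (\<lambda>J. c * x J)"
  shows "state \<phi>" and "\<phi> (A * word_comb n s m x) = cnj c * \<phi> A"
    and "\<phi> (star (word_comb n s m x) * A) = c * \<phi> A"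
proof -
  define U where "U = word_comb n s m x"
  have cc: "c * cnj c = 1" using c by (simp add: complex_norm_square[symmetric])
  have x': "(\<lambda>J. c * x J) \<in> unit_vectors n m" by (rule unit_vectors_scale[OF x(1) c])
  have V: "word_comb n s m (\<lambda>J. c * x J) = scaleC c U" by (simp add: word_comb_scale U_def)
  have iso: "star (scaleC c U) * scaleC c U = 1"
    using word_comb_isometry[OF R x'] by (simp only: V)
  note iff = sub_cuntz_state_iff[OF R x', unfolded V]
  have U_eq: "U = scaleC (cnj c) (scaleC c U)" using cc by (simp add: scaleC_scaleC mult.commute)
  have cov: "\<psi> (A * U) = cnj c * \<psi> A" "\<psi> (star U * A) = c * \<psi> A"
    if "sub_cuntz_state n s m (\<lambda>J. c * x J) \<psi>" for \<psi> A
  proof -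
    have \<psi>: "state \<psi>" "\<psi> (scaleC c U) = 1" using that iff by auto
    note lin = clinear_map_simps[OF stateD(1)[OF \<psi>(1)]]
    show "\<psi> (A * U) = cnj c * \<psi> A"
      by (subst U_eq) (simp only: mult_scaleC_right[of A "cnj c"] lin isometry_fixes_state(1)[OF \<psi>(1) iso \<psi>(2)])
    show "\<psi> (star U * A) = c * \<psi> A"
      by (subst U_eq) (simp only: star_scaleC[of "cnj c"] complex_cnj_cnj mult_scaleC_left[of c "star (scaleC c U)"]
          lin isometry_fixes_state(2)[OF \<psi>(1) iso \<psi>(2)])
  qed
  have uniq: "\<psi> = \<theta>" if \<psi>: "sub_cuntz_state n s m (\<lambda>J. c * x J) \<psi>"
    and \<theta>: "sub_cuntz_state n s m (\<lambda>J. c * x J) \<theta>" for \<psi> \<theta>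
  proof (rule ext)
    fix A
    have s: "state \<psi>" "state \<theta>" using \<psi> \<theta> iff by auto
    note lin = clinear_map_simps[OF stateD(1)[OF s(1)]] clinear_map_simps[OF stateD(1)[OF s(2)]]
    have "clinear_map (\<lambda>A. \<psi> A - \<theta> A)"
      by (simp add: clinear_map_def lin scaleC_complex_def algebra_simps)
    moreover have "continuous_on UNIV (\<lambda>A. \<psi> A - \<theta> A)"
      using state_vector_continuous(2)[OF s(1), of 1 1] state_vector_continuous(2)[OF s(2), of 1 1]
      by (intro continuous_on_diff) simp_all
    ultimately have "\<psi> A - \<theta> A = 0"
      by (rule covariant_functional_eq_zero[OF R gen x m, where \<alpha> = c and \<beta> = "cnj c"])
         (simp_all add: U_def[symmetric] cov[OF \<psi>] cov[OF \<theta>] c stateD(2)[OF s(1)]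
           stateD(2)[OF s(2)] right_diff_distrib)
    then show "\<psi> A = \<theta> A" by simp
  qed
  obtain \<psi> where \<psi>: "sub_cuntz_state n s m (\<lambda>J. c * x J) \<psi>"
    using exists_sub_cuntz_state[OF R n m x' st] by blast
  have "pure_state \<psi>"
    unfolding pure_state_def
  proof (intro conjI allI impI; (elim conjE)?)
    show "state \<psi>" using \<psi> iff by blast
    fix \<theta>1 \<theta>2 t
    assume s: "state \<theta>1" "state \<theta>2" and t: "0 < t" "t < (1::real)"
      and eq: "\<psi> = (\<lambda>a. complex_of_real t * \<theta>1 a + complex_of_real (1 - t) * \<theta>2 a)"
    have val: "1 = t * Re (\<theta>1 (scaleC c U)) + (1 - t) * Re (\<theta>2 (scaleC c U))"
      using arg_cong[OF fun_cong[OF eq, of "scaleC c U"], of Re] \<psi> iff by simp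
    have le: "cmod (\<theta> (scaleC c U)) \<le> 1" if "state \<theta>" for \<theta>
    proof -
      have "(cmod (\<theta> (scaleC c U)))\<^sup>2 \<le> 1"
        using state_square_le[OF that, of "scaleC c U"] stateD(2)[OF that] by (simp only: iso) simp
      then show ?thesis by (simp add: abs_square_le_1)
    qed
    then have re: "Re (\<theta>1 (scaleC c U)) \<le> 1" "Re (\<theta>2 (scaleC c U)) \<le> 1"
      using s complex_Re_le_cmod order_trans by blast+
    have eq1: "\<theta> (scaleC c U) = 1" if "state \<theta>" "Re (\<theta> (scaleC c U)) \<ge> 1" for \<theta>
    proof -
      have "cmod (\<theta> (scaleC c U)) = Re (\<theta> (scaleC c U))" "Re (\<theta> (scaleC c U)) = 1"
        using le[OF that(1)] that(2) complex_Re_le_cmod[of "\<theta> (scaleC c U)"] by linarith+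
      then show ?thesis using cmod_power2[of "\<theta> (scaleC c U)"] by (simp add: complex_eq_iff)
    qed
    have "t * (1 - Re (\<theta>1 (scaleC c U))) + (1 - t) * (1 - Re (\<theta>2 (scaleC c U))) = 0"
      using val by (simp add: algebra_simps)
    moreover have "t * (1 - Re (\<theta>1 (scaleC c U))) \<ge> 0" "(1 - t) * (1 - Re (\<theta>2 (scaleC c U))) \<ge> 0"
      using t re by simp_all
    ultimately have "t * (1 - Re (\<theta>1 (scaleC c U))) = 0" "(1 - t) * (1 - Re (\<theta>2 (scaleC c U))) = 0"
      by linarith+
    then have "\<theta>1 (scaleC c U) = 1" "\<theta>2 (scaleC c U) = 1"
      using t by (auto intro!: eq1 s)
    then show "\<theta>1 = \<psi>" "\<theta>2 = \<psi>" using s iff \<psi> by (auto intro!: uniq)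
  qed
  then have "\<phi> = \<psi>"
    unfolding \<phi>_def the_pure_sub_cuntz_state_def using \<psi> uniq by (intro the_equality) auto
  then show "state \<phi>" "\<phi> (A * word_comb n s m x) = cnj c * \<phi> A"
      "\<phi> (star (word_comb n s m x) * A) = c * \<phi> A"
    using \<psi> iff cov[OF \<psi>] by (auto simp: U_def)
qed

section \<open>Decomposition along the roots of unity\<close>

lemma sum_powers_root_of_unity:
  fixes r :: complex
  assumes "r ^ p = 1" and "r \<noteq> 1"
  shows "(\<Sum>k<p. r ^ k) = 0"
  using geometric_sum[OF assms(2), of p] assms(1) by simp

context
  fixes p :: nat and \<zeta> :: "nat \<Rightarrow> complex"
  assumes p: "p \<ge> 2"
    and zeta: "\<And>j. \<zeta> j = exp (2 * complex_of_real pi * of_nat j * \<i> / of_nat p)"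
begin

lemma norm_zeta [simp]: "cmod (\<zeta> j) = 1"
proof -
  have "2 * complex_of_real pi * of_nat j * \<i> / of_nat p = \<i> * of_real (2 * pi * j / p)"
    by (simp add: mult_ac)
  then show ?thesis by (simp only: zeta norm_exp_i_times)
qed

lemma zeta_cnj: "\<zeta> j * cnj (\<zeta> j) = 1"
  by (simp add: complex_norm_square[symmetric])

lemma zeta_power_p: "\<zeta> j ^ p = 1"
  using complex_root_unity[of p j] p by (simp add: zeta mult_ac)

lemma zeta_power_commute: "\<zeta> j ^ k = \<zeta> k ^ j"
  by (simp add: zeta exp_of_nat_mult[symmetric] mult_ac)

lemma zeta_eq_one_iff: "\<zeta> j = 1 \<longleftrightarrow> p dvd j"
  using complex_root_unity_eq_1[of p j] p by (simp add: zeta mult_ac)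

lemma zeta_inj:
  assumes "j \<in> {1..p}" and "k \<in> {1..p}" and "\<zeta> j = \<zeta> k"
  shows "j = k"
proof -
  have "j mod p = k mod p"
    using complex_root_unity_eq[of p j k] p assms(3) by (simp add: zeta mult_ac)
  then show ?thesis using assms(1,2) by (cases "j = p"; cases "k = p") auto
qed

lemma sum_zeta_powers: "k < p \<Longrightarrow> (\<Sum>j=1..p. \<zeta> j ^ k) = (if k = 0 then of_nat p else 0)"
proof (cases "k = 0")
  case False
  assume "k < p"
  have "(\<Sum>j=1..p. \<zeta> j ^ k) = (\<Sum>j=1..p. \<zeta> k ^ j)" by (simp only: zeta_power_commute)
  also have "\<dots> = (\<Sum>j<p. \<zeta> k ^ Suc j)" by (simp only: One_nat_def sum.atLeast1_atMost_eq)
  also have "\<dots> = \<zeta> k * (\<Sum>j<p. \<zeta> k ^ j)" by (simp add: sum_distrib_left)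
  also have "\<zeta> k \<noteq> 1" using \<open>k < p\<close> False by (auto simp: zeta_eq_one_iff dest: dvd_imp_le)
  then have "(\<Sum>j<p. \<zeta> k ^ j) = 0" by (rule sum_powers_root_of_unity[OF zeta_power_p])
  finally show ?thesis using False by simp
qed simp

lemma sum_zeta_orthogonal:
  assumes "j \<in> {1..p}" and "k \<in> {1..p}"
  shows "(\<Sum>l<p. (\<zeta> k * cnj (\<zeta> j)) ^ l) = (if j = k then of_nat p else 0)"
proof (cases "j = k")
  case False
  have "\<zeta> k * cnj (\<zeta> j) \<noteq> 1"
  proof
    assume "\<zeta> k * cnj (\<zeta> j) = 1"
    then have "\<zeta> k * (\<zeta> j * cnj (\<zeta> j)) = \<zeta> j" by (metis mult.assoc mult.commute mult_1_right)
    then show False using zeta_inj[OF assms] False by (simp add: zeta_cnj)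
  qed
  moreover have "(\<zeta> k * cnj (\<zeta> j)) ^ p = 1"
    by (simp add: power_mult_distrib zeta_power_p complex_cnj_power[symmetric] del: complex_cnj_power)
  ultimately show ?thesis using False by (simp add: sum_powers_root_of_unity)
qed (simp add: zeta_cnj)

text \<open>For a unitary \<open>U\<close> with \<open>U ^ p = 1\<close> this is the spectral projection for the eigenvalue
  \<open>cnj (\<zeta> j)\<close>.\<close>

definition spectral_part :: "'a::cstar_algebra \<Rightarrow> nat \<Rightarrow> 'a"
  where "spectral_part U j = (\<Sum>k<p. scaleC (\<zeta> j ^ k / of_nat p) (U ^ k))"

lemma sum_spectral_part: "(\<Sum>j=1..p. spectral_part U j) = 1"
proof -
  have "(\<Sum>j=1..p. spectral_part U j)
      = (\<Sum>k<p. \<Sum>j=1..p. scaleC (\<zeta> j ^ k / of_nat p) (U ^ k))"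
    unfolding spectral_part_def by (rule sum.swap)
  also have "\<dots> = (\<Sum>k<p. scaleC ((\<Sum>j=1..p. \<zeta> j ^ k) / of_nat p) (U ^ k))"
    by (simp only: scaleC_sum_left[symmetric] sum_divide_distrib)
  also have "\<dots> = (\<Sum>k<p. if k = 0 then 1 else 0)"
    using p by (intro sum.cong refl) (auto simp: sum_zeta_powers[unfolded One_nat_def])
  finally show ?thesis using p by simp
qed

lemma spectral_part_eigen:
  "scaleC (\<zeta> j) U * spectral_part U j = spectral_part U j + scaleC (1 / of_nat p) (U ^ p - 1)"
proof -
  define h where "h k = scaleC (\<zeta> j ^ k / of_nat p) (U ^ k)" for k
  have "scaleC (\<zeta> j) U * spectral_part U j = (\<Sum>k<p. h (Suc k))"
    unfolding spectral_part_def h_def sum_distrib_left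
    by (intro sum.cong refl)
       (simp add: mult_scaleC_left mult_scaleC_right scaleC_scaleC mult.commute)
  also have "\<dots> = (\<Sum>k<p. h k) + (h p - h 0)"
    using sum_lessThan_telescope[of h p] by (simp add: sum_subtractf algebra_simps)
  finally show ?thesis
    by (simp add: h_def spectral_part_def zeta_power_p scaleC_diff_right)
qed

text \<open>By the orthogonality of the characters of the cyclic group, evaluation at
  \<open>spectral_part U k\<close> singles out the \<open>k\<close>-th coefficient in a combination of covariant functionals.\<close>

lemma functional_spectral_part:
  assumes "clinear_map \<phi>" and "\<And>A. \<phi> (A * U) = cnj (\<zeta> j) * \<phi> A" and "\<phi> 1 = 1"
    and "j \<in> {1..p}" and "k \<in> {1..p}"
  shows "\<phi> (spectral_part U k) = (if j = k then 1 else 0)"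
proof -
  have "\<phi> (U ^ l) = cnj (\<zeta> j) ^ l" for l
  proof (induction l)
    case (Suc l)
    then show ?case using assms(2)[of "U ^ l"] by (simp add: power_commutes)
  qed (simp add: assms(3))
  then have "\<phi> (spectral_part U k) = (\<Sum>l<p. (\<zeta> k * cnj (\<zeta> j)) ^ l / of_nat p)"
    by (simp add: spectral_part_def clinear_map_simps[OF assms(1)] power_mult_distrib)
  then show ?thesis
    using p by (simp only: sum_divide_distrib[symmetric] sum_zeta_orthogonal[OF assms(4,5)]) simp
qed

text \<open>The GNS vector of \<open>\<omega>\<close> is the sum of its spectral parts \<open>P j\<close> for \<open>U\<close>.  The functionals
  \<open>A \<mapsto> \<omega> ((P j)\<^sup>* A (P k))\<close> are covariant, with factors \<open>\<zeta> j\<close> and \<open>cnj (\<zeta> k)\<close>, so they are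
  determined by their value at the identity; for \<open>j \<noteq> k\<close> this value is zero because \<open>U\<^sup>* U = 1\<close>
  forces it to be invariant under multiplication by \<open>\<zeta> j * cnj (\<zeta> k)\<close>.\<close>

lemma state_spectral_decomposition:
  fixes s :: "nat \<Rightarrow> 'a::cstar_algebra"
  assumes R: "cuntz_relations n s" and gen: "cstar_subalgebra hull (s ` {1..n}) = UNIV"
    and m: "m \<ge> 1" and x: "x \<in> unit_vectors n m" "nonperiodic n x"
    and st: "state \<omega>" and fixes_power: "\<omega> (word_comb n s m x ^ p) = 1"
    and \<phi>: "\<And>j. state (\<phi> j)" "\<And>j A. \<phi> j (A * word_comb n s m x) = cnj (\<zeta> j) * \<phi> j A"
      "\<And>j A. \<phi> j (star (word_comb n s m x) * A) = \<zeta> j * \<phi> j A"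
  defines "P \<equiv> spectral_part (word_comb n s m x)"
  shows "\<omega> A = (\<Sum>j=1..p. of_real (Re (\<omega> (star (P j) * P j))) * \<phi> j A)"
proof -
  note lin = clinear_map_simps[OF stateD(1)[OF st]]
  define U where "U = word_comb n s m x"
  note \<phi> = \<phi>[folded U_def]
  have U: "star U * U = 1" unfolding U_def by (rule word_comb_isometry[OF R x(1)])
  have Up: "star (U ^ p) * U ^ p = 1"
  proof -
    have "star (U ^ k) * U ^ k = 1" for k
    proof (induction k)
      case (Suc k)
      have "star (U ^ Suc k) * U ^ Suc k = star (U ^ k) * (star U * U) * U ^ k"
        by (simp only: power_Suc star_mult mult.assoc)
      then show ?case using Suc by (simp add: U)
    qed simp
    then show ?thesis .
  qed
  note fix_p = isometry_fixes_state[OF st Up fixes_power[folded U_def]]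
  define V where "V j = scaleC (\<zeta> j) U" for j
  have VP: "V j * P j = P j + scaleC (1 / of_nat p) (U ^ p - 1)" for j
    unfolding V_def P_def U_def by (rule spectral_part_eigen)
  have fix_right: "\<omega> (B * (V j * P j)) = \<omega> (B * P j)" for B j
    by (simp add: VP distrib_left mult_scaleC_right right_diff_distrib lin fix_p)
  have fix_left: "\<omega> (star (V j * P j) * B) = \<omega> (star (P j) * B)" for B j
    by (simp add: VP star_add star_scaleC star_diff distrib_right mult_scaleC_left
        left_diff_distrib lin fix_p)
  have U_eq: "U = scaleC (cnj (\<zeta> j)) (V j)" for j
    using zeta_cnj[of j] by (simp add: V_def scaleC_scaleC mult.commute)
  have left: "\<omega> (star (P j) * (star U * A) * P k) = \<zeta> j * \<omega> (star (P j) * A * P k)" for j k A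
  proof -
    have "star (P j) * (star U * A) * P k = scaleC (\<zeta> j) (star (V j * P j) * (A * P k))"
      by (subst U_eq[of j])
         (simp add: star_mult star_scaleC[of "cnj (\<zeta> j)"] mult_scaleC_left mult_scaleC_right mult.assoc)
    then show ?thesis by (simp add: lin fix_left mult.assoc)
  qed
  have right: "\<omega> (star (P j) * (A * U) * P k) = cnj (\<zeta> k) * \<omega> (star (P j) * A * P k)" for j k A
  proof -
    have "star (P j) * (A * U) * P k = scaleC (cnj (\<zeta> k)) ((star (P j) * A) * (V k * P k))"
      by (subst U_eq[of k]) (simp add: mult_scaleC_left mult_scaleC_right mult.assoc)
    then show ?thesis by (simp add: lin fix_right)
  qed
  have off_diagonal: "\<omega> (star (P j) * A * P k) = 0"
    if jk: "j \<in> {1..p}" "k \<in> {1..p}" "j \<noteq> k" for j k A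
  proof (rule covariant_functional_eq_zero[OF R gen x m state_vector_continuous[OF st],
        where \<alpha> = "\<zeta> j" and \<beta> = "cnj (\<zeta> k)"])
    show "\<omega> (star (P j) * 1 * P k) = 0"
    proof (rule ccontr)
      assume nz: "\<omega> (star (P j) * 1 * P k) \<noteq> 0"
      have "\<omega> (star (P j) * 1 * P k) = \<omega> (star (P j) * (star U * U) * P k)" by (simp only: U)
      also have "\<dots> = \<zeta> j * \<omega> (star (P j) * (1 * U) * P k)" by (simp only: left mult_1_left)
      also have "\<dots> = \<zeta> j * cnj (\<zeta> k) * \<omega> (star (P j) * 1 * P k)"
        by (simp only: right) (simp only: mult.assoc)
      finally have "\<omega> (star (P j) * 1 * P k) = \<zeta> j * cnj (\<zeta> k) * \<omega> (star (P j) * 1 * P k)" .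
      with nz have "\<zeta> j * cnj (\<zeta> k) = 1" by simp
      then have "\<zeta> j * (\<zeta> k * cnj (\<zeta> k)) = \<zeta> k" by (metis mult.assoc mult.commute mult_1_right)
      then show False using zeta_inj[OF jk(1,2)] jk(3) by (simp add: zeta_cnj)
    qed
  qed (simp_all add: U_def[symmetric] left right)
  have diagonal: "\<omega> (star (P j) * A * P j) = of_real (Re (\<omega> (star (P j) * P j))) * \<phi> j A" for j A
  proof -
    define a where "a = complex_of_real (Re (\<omega> (star (P j) * P j)))"
    have a: "\<omega> (star (P j) * P j) = a" unfolding a_def by (rule stateD(5)[OF st])
    note lin\<phi> = clinear_map_simps[OF stateD(1)[OF \<phi>(1)[of j]]]
    have "clinear_map (\<lambda>A. \<omega> (star (P j) * A * P j) - a * \<phi> j A)"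
      using state_vector_continuous(1)[OF st, of "star (P j)" "P j"]
      by (simp add: clinear_map_def lin\<phi> scaleC_complex_def algebra_simps)
    moreover have "continuous_on UNIV (\<lambda>A. \<omega> (star (P j) * A * P j) - a * \<phi> j A)"
      using state_vector_continuous(2)[OF \<phi>(1)[of j], of 1 1]
      by (intro continuous_on_diff continuous_on_mult_left state_vector_continuous(2)[OF st]) simp
    ultimately have "\<omega> (star (P j) * A * P j) - a * \<phi> j A = 0"
      by (rule covariant_functional_eq_zero[OF R gen x m, where \<alpha> = "\<zeta> j" and \<beta> = "cnj (\<zeta> j)"])
         (simp_all add: U_def[symmetric] left right \<phi> a stateD(2)[OF \<phi>(1)] right_diff_distrib)
    then show ?thesis by (simp add: a_def)
  qed
  have one: "(\<Sum>j=1..p. P j) = 1" unfolding P_def by (rule sum_spectral_part)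
  have "\<omega> A = \<omega> (star (\<Sum>j=1..p. P j) * A * (\<Sum>k=1..p. P k))" by (simp only: one) simp
  also have "\<dots> = (\<Sum>j=1..p. \<Sum>k=1..p. \<omega> (star (P j) * A * P k))"
    by (simp only: star_sum sum_distrib_right sum_distrib_left lin) (rule sum.swap)
  also have "\<dots> = (\<Sum>j=1..p. \<omega> (star (P j) * A * P j))"
  proof (intro sum.cong refl)
    fix j assume j: "j \<in> {1..p}"
    have "(\<Sum>k=1..p. \<omega> (star (P j) * A * P k)) = (\<Sum>k=1..p. if k = j then \<omega> (star (P j) * A * P j) else 0)"
      using off_diagonal[OF j] by (intro sum.cong refl) auto
    then show "(\<Sum>k=1..p. \<omega> (star (P j) * A * P k)) = \<omega> (star (P j) * A * P j)" using j by simp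
  qed
  finally show ?thesis by (simp only: diagonal)
qed

end

theorem theorem1p5:
  fixes s :: "nat \<Rightarrow> 'a::cstar_algebra"
    and n p m' :: nat
    and x z :: "nat list \<Rightarrow> complex"
    and \<omega> :: "'a \<Rightarrow> complex"
  assumes "n \<ge> 2" and "p \<ge> 2" and "m' \<ge> 1"
    and "cuntz_algebra TYPE('b::cstar_algebra) n s"
    and "x \<in> unit_vectors n m'" and "nonperiodic n x"
    and "z = tensor_power m' x p"
    and "sub_cuntz_state n s (m' * p) z \<omega>"
  shows "\<exists>!a. a \<in> prob_simplex p \<and>
    \<omega> = (\<lambda>A. \<Sum>j=1..p. complex_of_real (a j) *
      the_pure_sub_cuntz_state n s m'
        (\<lambda>J. exp (2 * complex_of_real pi * of_nat j * \<i> / of_nat p) * x J) A)"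
proof -
  define \<zeta> where "\<zeta> j = exp (2 * complex_of_real pi * of_nat j * \<i> / of_nat p)" for j
  define U where "U = word_comb n s m' x"
  define \<phi> where "\<phi> j = the_pure_sub_cuntz_state n s m' (\<lambda>J. \<zeta> j * x J)" for j
  have R: "cuntz_relations n s" and gen: "cstar_subalgebra hull (s ` {1..n}) = UNIV"
    using assms(4) by (simp_all add: cuntz_algebra_def)
  have st: "state \<omega>" and z: "z \<in> unit_vectors n (m' * p)"
    using assms(8) by (simp_all add: sub_cuntz_state_def)
  have Up: "\<omega> (U ^ p) = 1"
    using sub_cuntz_state_iff[OF R z, of \<omega>] assms(8)
    by (simp add: assms(7) word_comb_tensor_power U_def)
  have \<phi>: "state (\<phi> j)" "\<phi> j (A * U) = cnj (\<zeta> j) * \<phi> j A" "\<phi> j (star U * A) = \<zeta> j * \<phi> j A" for j A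
    using the_pure_sub_cuntz_state_rotated[OF R gen assms(1,3,5,6) st norm_zeta[OF assms(2) \<zeta>_def]]
    unfolding \<phi>_def U_def by blast+
  define P where "P = spectral_part p \<zeta> U"
  define a where "a = restrict (\<lambda>j. Re (\<omega> (star (P j) * P j))) {1..p}"
  have decomposition: "\<omega> A = (\<Sum>j=1..p. of_real (a j) * \<phi> j A)" for A
    using state_spectral_decomposition[OF assms(2) \<zeta>_def R gen assms(3,5,6) st Up[unfolded U_def]
        \<phi>[unfolded U_def], of A]
    by (simp add: a_def P_def U_def)
  have "complex_of_real (\<Sum>j=1..p. a j) = 1"
    using decomposition[of 1] by (simp add: stateD(2)[OF st] stateD(2)[OF \<phi>(1)])
  then have sum_a: "(\<Sum>j=1..p. a j) = 1" by (simp only: of_real_eq_1_iff)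
  have a: "a \<in> prob_simplex p"
    using sum_a by (simp add: prob_simplex_def a_def stateD(3)[OF st])
  have unique: "of_real (b k) = \<omega> (P k)"
    if b: "\<omega> = (\<lambda>A. \<Sum>j=1..p. of_real (b j) * \<phi> j A)" and k: "k \<in> {1..p}" for b k
  proof -
    have "\<omega> (P k) = (\<Sum>j=1..p. of_real (b j) * \<phi> j (P k))" by (rule fun_cong[OF b])
    also have "\<dots> = (\<Sum>j=1..p. if j = k then of_real (b j) else 0)"
      using functional_spectral_part[OF assms(2) \<zeta>_def stateD(1)[OF \<phi>(1)] \<phi>(2) stateD(2)[OF \<phi>(1)] _ k]
      by (intro sum.cong refl) (simp add: P_def)
    finally show ?thesis using k by simp
  qed
  have "b = a"
    if b: "b \<in> prob_simplex p" "\<omega> = (\<lambda>A. \<Sum>j=1..p. of_real (b j) * \<phi> j A)" for b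
  proof (rule extensionalityI[of _ "{1..p}"])
    fix k assume k: "k \<in> {1..p}"
    show "b k = a k"
      using unique[OF b(2) k] unique[OF ext[OF decomposition] k] by (metis of_real_eq_iff)
  qed (use a b(1) in \<open>simp_all add: prob_simplex_def\<close>)
  moreover have "\<omega> = (\<lambda>A. \<Sum>j=1..p. of_real (a j) * \<phi> j A)" by (rule ext[OF decomposition])
  ultimately have "\<exists>!a. a \<in> prob_simplex p \<and> \<omega> = (\<lambda>A. \<Sum>j=1..p. of_real (a j) * \<phi> j A)"
    using a by (intro ex1I[of _ a]) simp_all
  then show ?thesis unfolding \<phi>_def \<zeta>_def .
qed

end
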